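(* Let $d\ge2$ and let $\lambda\in\mathbb{R}$ satisfy $2d-4<|\lambda|<2d$. Let $D_0,D$ be open convex bounded domains in $\mathbb{R}^d$ with $D_0\cap\mathbb{Z}^d\neq\emptyset$, $D\cap\mathbb{Z}^d\ne\emptyset$ and $\operatorname{dist}(D,D_0)>\operatorname{diam}D$. Let $v_0,v:\mathbb{Z}^d\to\mathbb{C}$ satisfy $\operatorname{supp}v_0\subset D_0$, $\operatorname{supp}v\subset D$, $v_0\not\equiv0$, and let $A_1$ be the Born-approximation scattering amplitude at $\lambda$ of the potential $v+v_0$. Let $\mathcal{N}\subseteq\Gamma(\lambda)\times\mathbb{S}^{d-1}$ be an open nonempty neighbourhood of some fixed pair $(k,\omega)\in\Gamma(\lambda)\times\mathbb{S}^{d-1}$. Then the intensity $|A_1|^2=|A_1(k,\omega)|^2$ given on $\mathcal{N}$ uniquely determines $v$, assuming that $v_0$ is known a priori. That is, with $D_0,D,v_0$ fixed, if $v,w:\mathbb{Z}^d\to\mathbb{C}$ are both supported in $D$ and the squared moduli of the Born-approximation scattering amplitudes of $v+v_0$ and of $w+v_0$ at $\lambda$ coincide on $\mathcal{N}$, then $v=w$.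
   Context: $T^d=\mathbb{R}^d/2\pi\mathbb{Z}^d$, $\phi(k)=2\sum_{i=1}^d\cos k_i$, $\Gamma(\lambda)=\{k\in T^d:\phi(k)=\lambda\}$. For $2d-4<|\lambda|<2d$ the surface $\Gamma(\lambda)$ is smooth and strictly convex with non-zero principal curvatures, and for $\omega\in\mathbb{S}^{d-1}$, $\kappa(\omega,\lambda)$ denotes the unique point of $\Gamma(\lambda)$ with $\nabla\phi(\kappa)/|\nabla\phi(\kappa)|=\omega$. $K(\omega,\lambda)$ is the total curvature (product of principal curvatures) of $\Gamma(\lambda)$ at $\kappa(\omega,\lambda)$, and $\sigma=d-1$. Discrete Fourier transform: $\hat v(p)=(2\pi)^{-d/2}\sum_{x\in\mathbb{Z}^d}v(x)e^{-ip\cdot x}$, $p\in T^d$. For bounded sets: $\operatorname{diam}D=\sup_{x,y\in D}|x-y|$, $\operatorname{dist}(D,D_0)=\inf_{x\in D,\,y\in D_0}|x-y|$. The discrete Schrödinger equation is $\Delta\psi+v\psi-\lambda\psi=0$ on $\mathbb{Z}^d$, with $\Delta\psi(x)=\sum_{|x'-x|=1}\psi(x')$. The scattering amplitude of a compactly supported potential $v$ in the Born approximation (for small $v$) is the function $$A(k,\omega)=-\frac{\sqrt{2\pi}\,\hat v\big(\kappa(-\omega,\lambda)-k\big)\,e^{-i(\sigma+2)\pi/4}}{\sqrt{|K(\omega,\lambda)|}\,|\nabla\phi(\kappa(\omega,\lambda))|},\qquad k\in\Gamma(\lambda),\ \omega\in\mathbb{S}^{d-1}.$$ In the statement, scattering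 amplitudes mean these functions. *)

theory Defs
  imports "HOL-Analysis.Analysis"
begin

definition latt :: "int ^ 'n::finite \<Rightarrow> real ^ 'n"
  where "latt x = (\<chi> i. of_int (x $ i))"

lemma latt_0 [simp]: "latt 0 = 0"
  and latt_add: "latt (x + y) = latt x + latt y"
  and latt_minus: "latt (- x) = - latt x"
  by (simp_all add: latt_def vec_eq_iff)


section \<open>The torus\<close>

definition torus_rel :: "real ^ 'n::finite \<Rightarrow> real ^ 'n \<Rightarrow> bool"
  where "torus_rel x y \<longleftrightarrow> (\<exists>m. x = y + (2 * pi) *\<^sub>R latt m)"

lemma torus_rel_refl: "torus_rel x x"
  unfolding torus_rel_def by (rule exI[of _ 0]) simp

lemma torus_rel_sym: "torus_rel x y \<Longrightarrow> torus_rel y x"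
  unfolding torus_rel_def
proof (elim exE)
  fix m assume "x = y + (2 * pi) *\<^sub>R latt m"
  then show "\<exists>m. y = x + (2 * pi) *\<^sub>R latt m"
    by (intro exI[of _ "- m"]) (simp add: latt_minus)
qed

lemma torus_rel_add:
  assumes "torus_rel x y" "torus_rel x' y'"
  shows "torus_rel (x + x') (y + y')"
proof -
  from assms obtain m m' where "x = y + (2 * pi) *\<^sub>R latt m" "x' = y' + (2 * pi) *\<^sub>R latt m'"
    unfolding torus_rel_def by blast
  then have "x + x' = (y + y') + (2 * pi) *\<^sub>R latt (m + m')"
    by (simp add: latt_add scaleR_add_right)
  then show ?thesis unfolding torus_rel_def by blast
qed

lemma torus_rel_uminus:
  assumes "torus_rel x y" shows "torus_rel (- x) (- y)"
proof -
  from assms obtain m where "x = y + (2 * pi) *\<^sub>R latt m" unfolding torus_rel_def by blast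
  then have "- x = - y + (2 * pi) *\<^sub>R latt (- m)" by (simp add: latt_minus)
  then show ?thesis unfolding torus_rel_def by blast
qed

lemma torus_rel_trans:
  assumes "torus_rel x y" "torus_rel y z" shows "torus_rel x z"
proof -
  from assms obtain m m' where "x = y + (2 * pi) *\<^sub>R latt m" "y = z + (2 * pi) *\<^sub>R latt m'"
    unfolding torus_rel_def by blast
  then have "x = z + (2 * pi) *\<^sub>R latt (m' + m)" by (simp add: latt_add scaleR_add_right)
  then show ?thesis unfolding torus_rel_def by blast
qed

quotient_type 'n torus = "real ^ ('n::finite)" / torus_rel
  by (intro equivpI reflpI sympI transpI)
     (blast intro: torus_rel_refl torus_rel_sym torus_rel_trans)+

instantiation torus :: (finite) ab_group_add
begin

lift_definition zero_torus :: "'a torus" is 0 .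

lift_definition plus_torus :: "'a torus \<Rightarrow> 'a torus \<Rightarrow> 'a torus" is "(+)"
  by (rule torus_rel_add)

lift_definition uminus_torus :: "'a torus \<Rightarrow> 'a torus" is uminus
  by (rule torus_rel_uminus)

lift_definition minus_torus :: "'a torus \<Rightarrow> 'a torus \<Rightarrow> 'a torus" is "(-)"
  using torus_rel_add[OF _ torus_rel_uminus] by (metis diff_conv_add_uminus)

instance
  by standard (transfer; simp add: algebra_simps torus_rel_refl)+

end

instantiation torus :: (finite) topological_space
begin

text \<open>The quotient topology.\<close>

definition open_torus :: "'a torus set \<Rightarrow> bool"
  where "open_torus U \<longleftrightarrow> open (abs_torus -` U)"

instance
  by standard (auto simp: open_torus_def vimage_Union)

end


section \<open>Gradients and curvature of level surfaces\<close>

definition gradient :: "('a::real_inner \<Rightarrow> real) \<Rightarrow> 'a \<Rightarrow> 'a"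
  where "gradient f x = (THE D. GDERIV f x :> D)"

definition unit_normal :: "('a::real_inner \<Rightarrow> real) \<Rightarrow> 'a \<Rightarrow> 'a"
  where "unit_normal f x = gradient f x /\<^sub>R norm (gradient f x)"

definition level_tangent :: "('a::real_inner \<Rightarrow> real) \<Rightarrow> 'a \<Rightarrow> 'a set"
  where "level_tangent f x = {u. u \<bullet> gradient f x = 0}"

text \<open>Weingarten map, with respect to \<^term>\<open>unit_normal f\<close>, of the level set of \<^term>\<open>f\<close>
  through \<^term>\<open>x\<close>; to be applied to vectors of \<^term>\<open>level_tangent f x\<close> only.\<close>

definition shape_operator :: "('a::real_inner \<Rightarrow> real) \<Rightarrow> 'a \<Rightarrow> 'a \<Rightarrow> 'a"
  where "shape_operator f x u = - frechet_derivative (unit_normal f) (at x) u"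

definition curvature_space :: "('a::real_inner \<Rightarrow> real) \<Rightarrow> 'a \<Rightarrow> real \<Rightarrow> 'a set"
  where "curvature_space f x c = {u \<in> level_tangent f x. shape_operator f x u = c *\<^sub>R u}"

definition principal_curvatures :: "('a::real_inner \<Rightarrow> real) \<Rightarrow> 'a \<Rightarrow> real set"
  where "principal_curvatures f x = {c. \<exists>u \<in> curvature_space f x c. u \<noteq> 0}"

text \<open>The shape operator is self-adjoint on the tangent space, so the multiplicity of a principal
  curvature is the dimension of its eigenspace.\<close>

definition total_curvature :: "('a::euclidean_space \<Rightarrow> real) \<Rightarrow> 'a \<Rightarrow> real"
  where "total_curvature f x = (\<Prod>c\<in>principal_curvatures f x. c ^ dim (curvature_space f x c))"

lemma has_derivative_at_shift:
  fixes f :: "'a::real_normed_vector \<Rightarrow> 'b::real_normed_vector"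
  assumes "\<And>y. f (y + c) = f y"
  shows "(f has_derivative f') (at (x + c)) \<longleftrightarrow> (f has_derivative f') (at x)"
proof
  assume *: "(f has_derivative f') (at (x + c))"
  have "((\<lambda>y. y + c) has_derivative (\<lambda>y. y)) (at x)"
    by (auto intro!: derivative_eq_intros)
  from has_derivative_compose[OF this *] show "(f has_derivative f') (at x)"
    by (simp add: assms)
next
  assume *: "(f has_derivative f') (at x)"
  have "((\<lambda>y. y - c) has_derivative (\<lambda>y. y)) (at (x + c))"
    by (auto intro!: derivative_eq_intros)
  from has_derivative_compose[OF this, of f f'] * have "((\<lambda>y. f (y - c)) has_derivative f') (at (x + c))"
    by simp
  moreover have "f (y - c) = f y" for y using assms[of "y - c"] by simp
  ultimately show "(f has_derivative f') (at (x + c))" by simp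
qed

lemma gradient_shift:
  assumes "\<And>y. f (y + c) = f y"
  shows "gradient f (x + c) = gradient f x"
  unfolding gradient_def gderiv_def has_derivative_at_shift[of f, OF assms] ..

lemma total_curvature_shift:
  assumes "\<And>y. f (y + c) = f y"
  shows "total_curvature f (x + c) = total_curvature f x"
proof -
  have g: "gradient f (y + c) = gradient f y" for y by (rule gradient_shift[of f, OF assms])
  then have n: "unit_normal f (y + c) = unit_normal f y" for y by (simp add: unit_normal_def)
  have s: "shape_operator f (x + c) = shape_operator f x"
    by (rule ext)
       (simp add: shape_operator_def frechet_derivative_def has_derivative_at_shift[of "unit_normal f", OF n])
  show ?thesis
    by (simp add: total_curvature_def principal_curvatures_def curvature_space_def level_tangent_def g s)
qed


section \<open>The constant energy surface\<close>

definition phi_lift :: "real ^ 'n::finite \<Rightarrow> real"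
  where "phi_lift k = 2 * (\<Sum>i\<in>UNIV. cos (k $ i))"

lemma phi_lift_shift: "phi_lift (k + (2 * pi) *\<^sub>R latt m) = phi_lift k"
  unfolding phi_lift_def by (simp add: latt_def cos_add)

lift_definition phi :: "'n::finite torus \<Rightarrow> real" is phi_lift
  by (auto simp: torus_rel_def phi_lift_shift)

lift_definition grad_phi :: "'n::finite torus \<Rightarrow> real ^ 'n" is "gradient phi_lift"
  by (auto simp: torus_rel_def gradient_shift[of phi_lift, OF phi_lift_shift])

text \<open>Total curvature at \<^term>\<open>k\<close> of the level surface of \<^const>\<open>phi\<close> through \<^term>\<open>k\<close>.\<close>

lift_definition phi_curvature :: "'n::finite torus \<Rightarrow> real" is "total_curvature phi_lift"
  by (auto simp: torus_rel_def total_curvature_shift[of phi_lift, OF phi_lift_shift])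

definition Gamma_surface :: "real \<Rightarrow> 'n::finite torus set"
  where "Gamma_surface lam = {k. phi k = lam}"

definition kappa :: "real ^ 'n::finite \<Rightarrow> real \<Rightarrow> 'n torus"
  where "kappa \<omega> lam = (THE k. k \<in> Gamma_surface lam \<and> grad_phi k /\<^sub>R norm (grad_phi k) = \<omega>)"

definition curvature_K :: "real ^ 'n::finite \<Rightarrow> real \<Rightarrow> real"
  where "curvature_K \<omega> lam = phi_curvature (kappa \<omega> lam)"


section \<open>Fourier transform and Born amplitude\<close>

lemma cis_latt_shift:
  "exp (- (\<i> * of_real ((p + (2 * pi) *\<^sub>R latt m) \<bullet> latt x))) = exp (- (\<i> * of_real (p \<bullet> latt x)))"
proof -
  define n where "n = (\<Sum>i\<in>UNIV. m $ i * x $ i)"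
  have "latt m \<bullet> latt x = of_int n"
    by (simp add: inner_vec_def latt_def n_def)
  then have eq: "- (\<i> * of_real ((p + (2 * pi) *\<^sub>R latt m) \<bullet> latt x)) =
      - (\<i> * of_real (p \<bullet> latt x)) + of_int (2 * (- n)) * (of_real pi * \<i>)"
    by (simp add: inner_add_left algebra_simps)
  show ?thesis
    unfolding exp_eq by (intro exI[of _ "- n"]) (use eq in simp)
qed

lift_definition fourier :: "(int ^ 'n::finite \<Rightarrow> complex) \<Rightarrow> 'n torus \<Rightarrow> complex"
  is "\<lambda>v p. of_real ((2 * pi) powr (- real CARD('n) / 2)) *
        (\<Sum>\<^sub>\<infinity>x\<in>UNIV. v x * exp (- (\<i> * of_real (p \<bullet> latt x))))"
  by (auto simp: torus_rel_def cis_latt_shift)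

definition born_amplitude ::
  "real \<Rightarrow> (int ^ 'n::finite \<Rightarrow> complex) \<Rightarrow> 'n torus \<Rightarrow> real ^ 'n \<Rightarrow> complex"
  where "born_amplitude lam v k \<omega> =
    (let \<sigma> = real (CARD('n) - 1) in
      - (of_real (sqrt (2 * pi)) * fourier v (kappa (- \<omega>) lam - k)
          * exp (- (\<i> * of_real ((\<sigma> + 2) * pi / 4))))
      / of_real (sqrt \<bar>curvature_K \<omega> lam\<bar> * norm (grad_phi (kappa \<omega> lam))))"

end

theory Submission
  imports Defs
begin

text \<open>
Up to a positive factor that does not depend on the potential, the Born intensity at
\<open>(k, \<omega>)\<close> is \<open>|F (q - k)|\<^sup>2\<close>, where \<open>F\<close> is the Fourier transform of the potential and
\<open>q\<close> the point of the energy surface with unit normal \<open>- \<omega>\<close>. So the data are values of the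
trigonometric polynomial \<open>|F|\<^sup>2\<close> at differences of two points of the surface, and three
things have to be shown.

The factor is positive and finite (\<open>born_intensity\<close>). The point \<open>q\<close> must exist and be
unique (\<open>unit_normal_surjective\<close>, \<open>unit_normal_injective\<close>), and the curvature must not
vanish (\<open>total_curvature_nonzero\<close>). The gradient of \<open>phi_lift\<close> has the entries
\<open>- 2 sin x\<^sub>i\<close>, so a direction prescribes the sines of the coordinates up to a common positive
factor, and the energy prescribes the sum of their cosines. Since \<open>2 d - 4 < |\<lambda>|\<close>, at most
one cosine can have the sign opposite to \<open>\<lambda>\<close>, and it belongs to the largest sine. This
leaves a single real parameter, in which the equation for the energy has exactly one
solution.

The differences \<open>q - k\<close> fill an open set (\<open>momentum_transfers_open\<close>). At two points of the
surface with linearly independent normals the map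
\<open>(k, q) \<mapsto> (phi k, phi q, q - k)\<close> has a surjective derivative, so it is open there; the points
with normals \<open>\<plusminus> \<omega>\<close> have only countably many representatives, and \<open>k\<close> can be moved off
them inside the surface. Exponentials are linearly independent on every nonempty open set, so
the data determine all coefficients of \<open>|F|\<^sup>2\<close>, that is, the autocorrelation of the potential.

The autocorrelation of \<open>v + v0\<close> determines \<open>v\<close> (\<open>reference_determines\<close>). The
correlation of \<open>v\<close> with itself lives on \<open>D - D\<close>, the cross correlations on \<open>D - D0\<close> and on \<open>D0 - D\<close>. The distance condition
separates the first set from the second, and convexity separates the second from the
third. So on \<open>D - D0\<close> the autocorrelation shows the cross correlation of \<open>v\<close> with \<open>v0\<close>
alone. It is linear in \<open>v\<close>, and it is injective because the exponential sums have no zero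
divisors.
\<close>

section \<open>Exponential sums and the reference potential\<close>

text \<open>Induction on the number of frequencies: dividing by the exponential of one frequency makes
its term constant, and a directional derivative removes that term. The derivative is taken
along the difference of this frequency and the one under consideration, so that the
coefficient of the latter is multiplied by a nonzero number.\<close>

lemma exponentials_independent:
  fixes a :: "'a::real_inner \<Rightarrow> complex"
  assumes "finite Z" "open U" "p \<in> U"
    and "\<And>q. q \<in> U \<Longrightarrow> (\<Sum>z\<in>Z. a z * exp (- (\<i> * of_real (q \<bullet> z)))) = 0"
    and "z \<in> Z"
  shows "a z = 0"
  using assms(1,4,5)
proof (induction Z arbitrary: a z rule: finite_induct)
  case (insert z0 Z)
  define F where "F q = a z0 + (\<Sum>z\<in>Z. a z * exp (- (\<i> * of_real (q \<bullet> (z - z0)))))" for q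
  have shift: "exp (\<i> * of_real (q \<bullet> z0)) * exp (- (\<i> * of_real (q \<bullet> z))) = exp (- (\<i> * of_real (q \<bullet> (z - z0))))"
    for q z
    by (simp add: inner_diff_right algebra_simps flip: exp_add)
  have F0: "F q = 0" if "q \<in> U" for q
  proof -
    have "F q = exp (\<i> * of_real (q \<bullet> z0)) * (\<Sum>z\<in>insert z0 Z. a z * exp (- (\<i> * of_real (q \<bullet> z))))"
      using insert.hyps by (simp add: F_def sum_distrib_left ring_distribs mult.left_commute shift)
    then show ?thesis using insert.prems(1)[OF that] by simp
  qed
  have Z0: "a z = 0" if "z \<in> Z" for z
  proof -
    define e where "e = z - z0"
    have "e \<noteq> 0" using that insert.hyps(2) by (auto simp: e_def)
    define b where "b y = a y * of_real (e \<bullet> (y - z0))" for y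
    have "b z = 0"
    proof (rule insert.IH[OF _ that])
      fix q assume "q \<in> U"
      \<comment> \<open>The derivative of \<open>F\<close> at \<open>q\<close> in the direction \<open>e\<close>.\<close>
      define D where "D = (\<Sum>y\<in>Z. a y * (- (\<i> * of_real (e \<bullet> (y - z0)))) * exp (- (\<i> * of_real (q \<bullet> (y - z0)))))"
      have "((\<lambda>t. F (q + t *\<^sub>R e)) has_vector_derivative D) (at 0)"
        unfolding F_def D_def inner_add_left inner_scaleR_left of_real_add of_real_mult
        by (rule has_vector_derivative_eq_rhs,
            (rule derivative_intros has_vector_derivative_real_field | simp add: mult_ac)+)
      moreover have "((\<lambda>t. F (q + t *\<^sub>R e)) has_vector_derivative 0) (at 0)"
      proof (rule has_vector_derivative_transform_within_open)
        show "((\<lambda>_. 0) has_vector_derivative 0) (at 0)" by simp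
        show "open ((\<lambda>t. q + t *\<^sub>R e) -` U)"
          using \<open>open U\<close> by (intro open_vimage continuous_intros)
      qed (use \<open>q \<in> U\<close> F0 in auto)
      ultimately have "D = 0" by (rule vector_derivative_unique_at)
      have "(\<Sum>y\<in>Z. b y * exp (- (\<i> * of_real (q \<bullet> y)))) =
          exp (- (\<i> * of_real (q \<bullet> z0))) * (\<i> * D)"
        by (simp add: D_def b_def sum_distrib_left mult_ac flip: shift)
           (simp add: exp_minus field_simps)
      then show "(\<Sum>y\<in>Z. b y * exp (- (\<i> * of_real (q \<bullet> y)))) = 0"
        using \<open>D = 0\<close> by simp
    qed
    then show ?thesis using \<open>e \<noteq> 0\<close> by (simp add: b_def e_def)
  qed
  with F0[OF \<open>p \<in> U\<close>] have "a z0 = 0" by (simp add: F_def)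
  with Z0 insert.prems(2) show ?case by auto
qed simp

text \<open>For the squared modulus of a Fourier transform the index is a pair of lattice points and the
frequency is their difference, so different indices share a frequency.\<close>

lemma exponentials_independent_family:
  fixes f :: "'i \<Rightarrow> 'a::real_inner" and a :: "'i \<Rightarrow> complex"
  assumes "finite I" "open U" "p \<in> U"
    and 0: "\<And>q. q \<in> U \<Longrightarrow> (\<Sum>i\<in>I. a i * exp (- (\<i> * of_real (q \<bullet> f i)))) = 0"
  shows "(\<Sum>i | i \<in> I \<and> f i = z. a i) = 0"
proof (cases "z \<in> f ` I")
  case True
  show ?thesis
  proof (rule exponentials_independent[where a = "\<lambda>z. \<Sum>i | i \<in> I \<and> f i = z. a i", OF _ assms(2,3) _ True])
    fix q assume "q \<in> U"
    have "(\<Sum>z\<in>f ` I. (\<Sum>i | i \<in> I \<and> f i = z. a i) * exp (- (\<i> * of_real (q \<bullet> z)))) =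
        (\<Sum>z\<in>f ` I. \<Sum>i | i \<in> I \<and> f i = z. a i * exp (- (\<i> * of_real (q \<bullet> f i))))"
      by (simp add: sum_distrib_right)
    also have "\<dots> = (\<Sum>i\<in>I. a i * exp (- (\<i> * of_real (q \<bullet> f i))))"
      by (rule sum.image_gen[symmetric]) fact
    finally show "(\<Sum>z\<in>f ` I. (\<Sum>i | i \<in> I \<and> f i = z. a i) * exp (- (\<i> * of_real (q \<bullet> z)))) = 0"
      using 0[OF \<open>q \<in> U\<close>] by simp
  qed (use \<open>finite I\<close> in simp)
next
  case False
  then have "{i. i \<in> I \<and> f i = z} = {}" by auto
  then show ?thesis by (simp only: sum.empty)
qed

definition trig_poly :: "'i set \<Rightarrow> ('i \<Rightarrow> 'a::real_inner) \<Rightarrow> ('i \<Rightarrow> complex) \<Rightarrow> 'a \<Rightarrow> complex"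
  where "trig_poly S e u p = (\<Sum>x\<in>S. u x * exp (- (\<i> * of_real (p \<bullet> e x))))"

lemma trig_poly_mult_cnj:
  "trig_poly S e u p * cnj (trig_poly S e g p) =
    (\<Sum>(x, y)\<in>S \<times> S. (u x * cnj (g y)) * exp (- (\<i> * of_real (p \<bullet> (e x - e y)))))"
proof -
  have "exp (- (\<i> * of_real (p \<bullet> e x))) * cnj (exp (- (\<i> * of_real (p \<bullet> e y)))) =
      exp (- (\<i> * of_real (p \<bullet> (e x - e y))))" for x y
    unfolding exp_cnj exp_add[symmetric] by (simp add: inner_diff_right algebra_simps)
  then have "(u x * exp (- (\<i> * of_real (p \<bullet> e x)))) * cnj (g y * exp (- (\<i> * of_real (p \<bullet> e y)))) =
      (u x * cnj (g y)) * exp (- (\<i> * of_real (p \<bullet> (e x - e y))))" for x y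
    by (simp add: mult_ac)
  then show ?thesis
    unfolding trig_poly_def cnj_sum sum_product sum.cartesian_product by (simp only: case_prod_unfold)
qed

lemma trig_poly_eq_0_imp:
  assumes "finite S" "inj_on e S" "open U" "p \<in> U" "\<And>q. q \<in> U \<Longrightarrow> trig_poly S e u q = 0" "x \<in> S"
  shows "u x = 0"
proof -
  have "(\<Sum>y | y \<in> S \<and> e y = e x. u y) = 0"
    using assms(1,3-5) unfolding trig_poly_def by (rule exponentials_independent_family)
  also have "{y. y \<in> S \<and> e y = e x} = {x}" using assms(2,6) by (auto dest: inj_onD)
  finally show ?thesis by simp
qed

text \<open>The second factor is nonzero somewhere, by continuity it is nonzero on a nonempty open set,
and the first factor vanishes there.\<close>

lemma trig_poly_no_zero_divisors:
  assumes "finite S" "inj_on e S" and 0: "\<And>p. trig_poly S e u p * trig_poly S e g p = 0"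
    and "y \<in> S" "g y \<noteq> 0" and "x \<in> S"
  shows "u x = 0"
proof -
  obtain p where p: "trig_poly S e g p \<noteq> 0"
    using trig_poly_eq_0_imp[OF assms(1,2) open_UNIV UNIV_I, where u = g and x = y] assms(4,5) by blast
  have "continuous_on UNIV (trig_poly S e g)"
    unfolding trig_poly_def by (intro continuous_intros)
  then have "open (trig_poly S e g -` (- {0}))" by (intro open_vimage) auto
  from trig_poly_eq_0_imp[OF assms(1,2) this, where u = u and x = x and p = p] show ?thesis using p 0 \<open>x \<in> S\<close> by auto
qed

text \<open>An equality \<open>x' - y' = x - y\<close> inside \<open>D\<close> would bound the distance of \<open>x\<close> and \<open>y\<close> by the
diameter. An equality \<open>y' - x' = x - y\<close> would give the segments from \<open>x\<close> to \<open>x'\<close> and from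
\<open>y\<close> to \<open>y'\<close> a common midpoint, which would lie in both convex sets.\<close>

lemma correlations_separate:
  fixes D D0 :: "'a::euclidean_space set"
  assumes "convex D" "convex D0" "bounded D" and far: "diameter D < setdist D D0"
    and "x \<in> D" "y \<in> D0"
  shows "x' \<in> D \<Longrightarrow> y' \<in> D \<Longrightarrow> x' - y' \<noteq> x - y"
    and "y' \<in> D0 \<Longrightarrow> x' \<in> D \<Longrightarrow> y' - x' \<noteq> x - y"
proof -
  have "setdist D D0 \<le> dist x y" using assms by (intro setdist_le_dist)
  then have big: "diameter D < norm (x - y)" using far by (simp add: dist_norm)
  show "x' - y' \<noteq> x - y" if "x' \<in> D" "y' \<in> D"
    using diameter_bounded_bound[OF \<open>bounded D\<close> that] big by (auto simp: dist_norm)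
  show "y' - x' \<noteq> x - y" if "y' \<in> D0" "x' \<in> D"
  proof
    assume "y' - x' = x - y"
    then have "x + x' = y + y'" by (simp add: algebra_simps)
    then have "(1/2) *\<^sub>R x + (1/2) *\<^sub>R x' = (1/2) *\<^sub>R y + (1/2) *\<^sub>R y'"
      by (metis scaleR_add_right)
    moreover have "(1/2) *\<^sub>R x + (1/2) *\<^sub>R x' \<in> D"
      using \<open>convex D\<close> \<open>x \<in> D\<close> \<open>x' \<in> D\<close> by (intro convexD) auto
    moreover have "(1/2) *\<^sub>R y + (1/2) *\<^sub>R y' \<in> D0"
      using \<open>convex D0\<close> \<open>y \<in> D0\<close> \<open>y' \<in> D0\<close> by (intro convexD) auto
    ultimately have "setdist D D0 \<le> 0" by (metis dist_self setdist_le_dist)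
    with far diameter_ge_0[OF \<open>bounded D\<close>] show False by simp
  qed
qed

text \<open>The coefficients of the difference of the two squared moduli vanish. At a frequency in
\<open>D - D0\<close> such a coefficient only collects terms of the product on the left-hand side, by
the separation of the correlations; at other frequencies this product has no terms.\<close>

lemma reference_cross_term_vanishes:
  fixes e :: "'i \<Rightarrow> 'a::euclidean_space"
  assumes "finite S" "convex D" "convex D0" "bounded D" "diameter D < setdist D D0"
    and v: "\<And>x. v x \<noteq> 0 \<Longrightarrow> e x \<in> D" and w: "\<And>x. w x \<noteq> 0 \<Longrightarrow> e x \<in> D"
    and v0: "\<And>x. v0 x \<noteq> 0 \<Longrightarrow> e x \<in> D0"
    and "open U" "p \<in> U"
    and mod: "\<And>q. q \<in> U \<Longrightarrow> cmod (trig_poly S e (\<lambda>x. v x + v0 x) q) = cmod (trig_poly S e (\<lambda>x. w x + v0 x) q)"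
  shows "trig_poly S e (\<lambda>x. v x - w x) q * cnj (trig_poly S e v0 q) = 0"
proof -
  define d where "d = (\<lambda>(x, y). e x - e y)"
  define b where "b = (\<lambda>(x, y). (v x + v0 x) * cnj (v y + v0 y) - (w x + v0 x) * cnj (w y + v0 y))"
  define h where "h = (\<lambda>(x, y). (v x - w x) * cnj (v0 y))"
  have b0: "(\<Sum>xy | xy \<in> S \<times> S \<and> d xy = z. b xy) = 0" for z
  proof (rule exponentials_independent_family[OF _ \<open>open U\<close> \<open>p \<in> U\<close>])
    fix q assume "q \<in> U"
    have "(\<Sum>xy\<in>S \<times> S. b xy * exp (- (\<i> * of_real (q \<bullet> d xy)))) =
        trig_poly S e (\<lambda>x. v x + v0 x) q * cnj (trig_poly S e (\<lambda>x. v x + v0 x) q) -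
        trig_poly S e (\<lambda>x. w x + v0 x) q * cnj (trig_poly S e (\<lambda>x. w x + v0 x) q)"
      by (simp add: trig_poly_mult_cnj b_def d_def case_prod_unfold left_diff_distrib sum_subtractf)
    also have "\<dots> = 0" using mod[OF \<open>q \<in> U\<close>] by (simp flip: complex_norm_square)
    finally show "(\<Sum>xy\<in>S \<times> S. b xy * exp (- (\<i> * of_real (q \<bullet> d xy)))) = 0" .
  qed (use \<open>finite S\<close> in simp)
  have h0: "(\<Sum>xy | xy \<in> S \<times> S \<and> d xy = z. h xy) = 0" for z
  proof (cases "\<exists>x\<in>D. \<exists>y\<in>D0. z = x - y")
    case True
    then obtain x y where xy: "x \<in> D" "y \<in> D0" "z = x - y" by blast
    note sep = correlations_separate[OF assms(2-5) xy(1,2)]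
    have "h (x', y') = b (x', y')" if "d (x', y') = z" for x' y'
    proof -
      have dd: "e x' - e y' = x - y" using that xy by (simp add: d_def)
      have *: "\<not> (e x' \<in> D \<and> e y' \<in> D)" "\<not> (e x' \<in> D0 \<and> e y' \<in> D)" using sep dd by blast+
      have "v x' * cnj (v y') = 0" "w x' * cnj (w y') = 0" "v0 x' * cnj (v y') = 0" "v0 x' * cnj (w y') = 0"
        using * v w v0 by auto
      then show ?thesis by (auto simp: h_def b_def algebra_simps)
    qed
    then have "(\<Sum>xy | xy \<in> S \<times> S \<and> d xy = z. h xy) = (\<Sum>xy | xy \<in> S \<times> S \<and> d xy = z. b xy)"
      by (intro sum.cong) auto
    then show ?thesis using b0 by simp
  next
    case False
    have "h (x', y') = 0" if "d (x', y') = z" for x' y'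
    proof -
      have "v x' - w x' = 0 \<or> v0 y' = 0"
        using False that v[of x'] w[of x'] v0[of y'] by (fastforce simp: d_def)
      then show ?thesis by (auto simp: h_def)
    qed
    then show ?thesis by (intro sum.neutral) auto
  qed
  have "trig_poly S e (\<lambda>x. v x - w x) q * cnj (trig_poly S e v0 q) =
      (\<Sum>xy\<in>S \<times> S. h xy * exp (- (\<i> * of_real (q \<bullet> d xy))))"
    by (simp add: trig_poly_mult_cnj h_def d_def case_prod_unfold)
  also have "\<dots> = (\<Sum>z\<in>d ` (S \<times> S). \<Sum>xy | xy \<in> S \<times> S \<and> d xy = z. h xy * exp (- (\<i> * of_real (q \<bullet> d xy))))"
    by (rule sum.image_gen) (use \<open>finite S\<close> in simp)
  also have "\<dots> = (\<Sum>z\<in>d ` (S \<times> S). (\<Sum>xy | xy \<in> S \<times> S \<and> d xy = z. h xy) * exp (- (\<i> * of_real (q \<bullet> z))))"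
    by (intro sum.cong refl) (simp add: sum_distrib_right)
  also have "\<dots> = 0" by (simp add: h0)
  finally show ?thesis .
qed

lemma reference_determines:
  fixes e :: "'i \<Rightarrow> 'a::euclidean_space"
  assumes "finite S" "inj_on e S" "convex D" "convex D0" "bounded D" "diameter D < setdist D D0"
    and v: "\<And>x. v x \<noteq> 0 \<Longrightarrow> e x \<in> D" and w: "\<And>x. w x \<noteq> 0 \<Longrightarrow> e x \<in> D"
    and v0: "\<And>x. v0 x \<noteq> 0 \<Longrightarrow> e x \<in> D0"
    and "y \<in> S" "v0 y \<noteq> 0" and "open U" "p \<in> U"
    and mod: "\<And>q. q \<in> U \<Longrightarrow> cmod (trig_poly S e (\<lambda>x. v x + v0 x) q) = cmod (trig_poly S e (\<lambda>x. w x + v0 x) q)"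
    and "x \<in> S"
  shows "v x = w x"
proof -
  have "trig_poly S e (\<lambda>x. v x - w x) q * cnj (trig_poly S e v0 q) = 0" for q
    using assms(1,3-6) v w v0 assms(12,13) mod by (rule reference_cross_term_vanishes)
  then have "trig_poly S e (\<lambda>x. v x - w x) q * trig_poly S e v0 q = 0" for q by simp
  from trig_poly_no_zero_divisors[OF assms(1,2) this assms(10,11,15)] show ?thesis by simp
qed

section \<open>Points of the unit circle with prescribed ratios of sines\<close>

text \<open>Two cosines cannot both be nonpositive, as the others add up to at most \<open>d - 2\<close>; in fact the
sum of any two is positive. The cosine that belongs to the largest sine has the smallest
modulus, so the other ones are positive.\<close>

lemma cos_dominates:
  fixes c s :: "'n::finite \<Rightarrow> real"
  assumes circ: "\<And>i. (c i)\<^sup>2 + (s i)\<^sup>2 = 1" and low: "real CARD('n) - 2 < sum c UNIV"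
    and max: "\<And>i. \<bar>s i\<bar> \<le> \<bar>s j\<bar>" and "i \<noteq> j"
  shows "0 < c i" and "\<bar>c j\<bar> \<le> c i"
proof -
  have c1: "c l \<le> 1" for l using circ[of l] by (smt (verit) one_power2 power2_le_imp_le zero_le_power2)
  have "sum c UNIV = c i + c j + (\<Sum>l\<in>UNIV - {i, j}. c l)"
    using \<open>i \<noteq> j\<close> by (subst sum.subset_diff[of "{i, j}"]) auto
  also have "(\<Sum>l\<in>UNIV - {i, j}. c l) \<le> (\<Sum>l\<in>UNIV - {i, j}. 1)" by (intro sum_mono c1)
  also have "(\<Sum>l\<in>UNIV - {i, j}. 1) = real CARD('n) - 2"
  proof -
    have "card {i, j} \<le> CARD('n)" by (intro card_mono) auto
    then show ?thesis using \<open>i \<noteq> j\<close> by (simp add: card_Diff_subset)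
  qed
  finally have pos: "0 < c i + c j" using low by simp
  have "(s i)\<^sup>2 \<le> (s j)\<^sup>2" using max[of i] by (simp add: abs_le_square_iff)
  then have "(c j)\<^sup>2 \<le> (c i)\<^sup>2" using circ[of i] circ[of j] by linarith
  then have le: "\<bar>c j\<bar> \<le> \<bar>c i\<bar>" by (simp add: abs_le_square_iff)
  show "0 < c i" "\<bar>c j\<bar> \<le> c i" using pos le by linarith+
qed

lemma sum_one_minus_other_cos:
  fixes c :: "'n::finite \<Rightarrow> real"
  shows "(\<Sum>i\<in>UNIV - {j}. 1 - c i) = real CARD('n) - 1 + c j - sum c UNIV"
proof -
  have "sum c UNIV = c j + (\<Sum>i\<in>UNIV - {j}. c i)" by (simp add: sum.remove)
  moreover have "CARD('n) \<ge> 1" by (simp add: Suc_leI)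
  ultimately show ?thesis by (simp add: sum_subtractf card_Diff_subset of_nat_diff)
qed

text \<open>Otherwise all sines vanish, all cosines are \<open>\<plusminus> 1\<close>, and their sum is \<open>d\<close> or at most
\<open>d - 2\<close>. This says that the energies considered are not critical values.\<close>

lemma max_sin_nonzero:
  fixes c s :: "'n::finite \<Rightarrow> real"
  assumes circ: "\<And>i. (c i)\<^sup>2 + (s i)\<^sup>2 = 1"
    and low: "real CARD('n) - 2 < sum c UNIV" and up: "sum c UNIV < real CARD('n)"
    and max: "\<And>i. \<bar>s i\<bar> \<le> \<bar>s j\<bar>"
  shows "s j \<noteq> 0"
proof
  assume "s j = 0"
  then have s0: "s i = 0" for i using max[of i] by simp
  have c1: "c i = 1 \<or> c i = -1" for i using circ[of i] by (simp add: s0 power2_eq_1_iff)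
  have "c i = 1" if "i \<noteq> j" for i
    using cos_dominates(1)[OF circ low max that] c1[of i] by auto
  then have "(\<Sum>i\<in>UNIV - {j}. 1 - c i) = 0" by simp
  with c1[of j] low up show False by (auto simp: sum_one_minus_other_cos)
qed

lemma ex_max_abs: "\<exists>j. \<forall>i. \<bar>f i\<bar> \<le> \<bar>f j\<bar>" for f :: "'n::finite \<Rightarrow> real"
proof -
  have "Max (range (\<lambda>i. \<bar>f i\<bar>)) \<in> range (\<lambda>i. \<bar>f i\<bar>)" by (intro Max_in) auto
  then obtain j where "\<bar>f j\<bar> = Max (range (\<lambda>i. \<bar>f i\<bar>))" by (metis imageE)
  then show ?thesis by (intro exI[of _ j]) simp
qed

text \<open>With \<open>c\<close> the cosines and \<open>s\<close> the sines at a point of the surface, the hypotheses say that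
\<open>u\<close> is tangent and that the Hessian maps \<open>u\<close> to a multiple of the normal. Unless this
multiple is zero, they force \<open>\<Sum> s\<^sub>i\<^sup>2 / c\<^sub>i = 0\<close>. If the exceptional cosine
is \<open>- a < 0\<close>, then the other cosines are at least \<open>a\<close> and the terms
\<open>(1 - c\<^sub>i) (1 + 1 / c\<^sub>i)\<close> of the other coordinates have a sum less than
\<open>(1 - a) (1 + 1 / a) = (1 - a\<^sup>2) / a\<close>, which is what the exceptional term subtracts.\<close>

lemma second_form_nondegenerate:
  fixes c s u :: "'n::finite \<Rightarrow> real"
  assumes circ: "\<And>i. (c i)\<^sup>2 + (s i)\<^sup>2 = 1"
    and low: "real CARD('n) - 2 < sum c UNIV" and up: "sum c UNIV < real CARD('n)"
    and tan: "(\<Sum>i\<in>UNIV. s i * u i) = 0" and eig: "\<And>i. c i * u i = b * s i"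
  shows "u i = 0"
proof -
  obtain j where max: "\<And>i. \<bar>s i\<bar> \<le> \<bar>s j\<bar>"
    using ex_max_abs[of s] by blast
  note dom = cos_dominates[OF circ low max]
  have sj: "s j \<noteq> 0" by (rule max_sin_nonzero[OF circ low up max])
  have "b = 0"
  proof (rule ccontr)
    assume "b \<noteq> 0"
    then have "c j \<noteq> 0" using eig[of j] sj by auto
    then have nz: "c i \<noteq> 0" for i using dom(1)[of i] by (cases "i = j") auto
    have u: "u i = b * (s i / c i)" for i using eig[of i] nz[of i] by (simp add: field_simps)
    have "(\<Sum>i\<in>UNIV. s i * u i) = b * (\<Sum>i\<in>UNIV. (s i)\<^sup>2 / c i)"
      by (simp add: u sum_distrib_left power2_eq_square mult_ac)
    with tan \<open>b \<noteq> 0\<close> have "(\<Sum>i\<in>UNIV. (s i)\<^sup>2 / c i) = 0" by simp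
    then have zero: "(s j)\<^sup>2 / c j + (\<Sum>i\<in>UNIV - {j}. (s i)\<^sup>2 / c i) = 0"
      by (simp add: sum.remove)
    show False
    proof (cases "c j > 0")
      case True
      then have "(s j)\<^sup>2 / c j > 0" using sj by simp
      moreover have "(\<Sum>i\<in>UNIV - {j}. (s i)\<^sup>2 / c i) \<ge> 0"
        using dom(1) by (intro sum_nonneg divide_nonneg_pos) auto
      ultimately show False using zero by linarith
    next
      case False
      define a where "a = - c j"
      have a: "a > 0" using False \<open>c j \<noteq> 0\<close> by (simp add: a_def)
      have "(\<Sum>i\<in>UNIV - {j}. (s i)\<^sup>2 / c i) \<le> (\<Sum>i\<in>UNIV - {j}. (1 - c i) * (1 + 1 / a))"
      proof (rule sum_mono)
        fix i assume "i \<in> UNIV - {j}"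
        then have ci: "c i > 0" "a \<le> c i" using dom[of i] by (auto simp: a_def)
        have "c i \<le> 1" using circ[of i]
          by (smt (verit) one_power2 power2_le_imp_le zero_le_power2)
        have "(s i)\<^sup>2 = (1 - c i) * (1 + c i)" using circ[of i] by (simp add: algebra_simps power2_eq_square)
        then have "(s i)\<^sup>2 / c i = (1 - c i) * (1 + 1 / c i)" using ci by (simp add: field_simps)
        also have "\<dots> \<le> (1 - c i) * (1 + 1 / a)"
          using ci a \<open>c i \<le> 1\<close> by (intro mult_left_mono add_left_mono frac_le) auto
        finally show "(s i)\<^sup>2 / c i \<le> (1 - c i) * (1 + 1 / a)" .
      qed
      also have "\<dots> = (\<Sum>i\<in>UNIV - {j}. 1 - c i) * (1 + 1 / a)" by (simp add: sum_distrib_right)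
      also have "\<dots> < (1 - a) * (1 + 1 / a)"
        using low a by (intro mult_strict_right_mono) (auto simp: sum_one_minus_other_cos a_def add_pos_pos)
      also have "\<dots> = (1 - a\<^sup>2) / a" using a by (simp add: field_simps power2_eq_square)
      also have "1 - a\<^sup>2 = (s j)\<^sup>2" using circ[of j] by (simp add: a_def)
      finally show False using zero by (simp add: a_def)
    qed
  qed
  then have u0: "u i = 0" if "i \<noteq> j" for i using eig[of i] dom(1)[OF that] by simp
  then have "(\<Sum>i\<in>UNIV. s i * u i) = s j * u j" by (simp add: sum.remove[of _ j])
  with tan sj have "u j = 0" by simp
  with u0 show ?thesis by (cases "i = j") auto
qed

text \<open>For fixed \<open>r\<close> let \<open>c\<close> be the positive root of \<open>1 - r (1 - x\<^sup>2)\<close>. The claim is that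
\<open>(1 - c) / (1 + x) = r (1 - x) / (1 + c)\<close> does not increase with \<open>x\<close>.\<close>

lemma cos_deficit_ratio_mono:
  fixes x y :: real
  assumes "-1 < x" "x < y" "y < 1" "\<bar>x\<bar> \<le> c" "\<bar>y\<bar> \<le> d" "0 < c" "0 < d"
    and r: "0 \<le> r" "r \<le> 1" and c2: "c\<^sup>2 = 1 - r * (1 - x\<^sup>2)" and d2: "d\<^sup>2 = 1 - r * (1 - y\<^sup>2)"
  shows "(1 - d) * (1 + x) \<le> (1 - c) * (1 + y)"
proof -
  have key: "(1 - y) * (1 + c) \<le> (1 - x) * (1 + d)"
  proof -
    have "(c - d) * (c + d) = r * (x\<^sup>2 - y\<^sup>2)" using c2 d2 by (simp add: algebra_simps power2_eq_square)
    also have "\<dots> = (y - x) * (r * (- x - y))" by (simp add: algebra_simps power2_eq_square)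
    also have "\<dots> \<le> (y - x) * (c + d)"
    proof (intro mult_left_mono)
      have "r * (- x - y) \<le> r * (c + d)" using assms by (intro mult_left_mono) auto
      also have "\<dots> \<le> 1 * (c + d)" using assms by (intro mult_right_mono) auto
      finally show "r * (- x - y) \<le> c + d" by simp
    qed (use assms in auto)
    finally have cd: "c - d \<le> y - x" using assms by simp
    have "(1 - y) * (c - d) \<le> (1 + d) * (y - x)"
    proof (cases "c \<le> d")
      case True
      then have "(1 - y) * (c - d) \<le> 0" using assms by (intro mult_nonneg_nonpos) auto
      also have "0 \<le> (1 + d) * (y - x)" using assms by simp
      finally show ?thesis .
    next
      case False
      then show ?thesis using assms cd by (intro mult_mono) auto
    qed
    then show ?thesis by (simp add: algebra_simps)
  qed
  have e: "(1 - c) * (1 + c) = r * ((1 - x) * (1 + x))" "(1 - d) * (1 + d) = r * ((1 - y) * (1 + y))"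
    using c2 d2 by (auto simp: algebra_simps power2_eq_square)
  then have f: "1 - c = r * (1 - x) * (1 + x) / (1 + c)" "1 - d = r * (1 - y) * (1 + y) / (1 + d)"
    using assms by (simp_all add: field_simps)
  have "(1 - y) / (1 + d) \<le> (1 - x) / (1 + c)" using key assms by (simp add: field_simps)
  then have "(r * (1 + x) * (1 + y)) * ((1 - y) / (1 + d)) \<le> (r * (1 + x) * (1 + y)) * ((1 - x) / (1 + c))"
    using assms by (intro mult_left_mono) auto
  then show ?thesis by (simp add: f mult_ac)
qed

text \<open>Put \<open>x = c j\<close> and let \<open>\<delta> > 0\<close> be the excess of the sum of the cosines over \<open>d - 2\<close>. Then the
sum of \<open>1 - c i\<close> over the other coordinates is \<open>1 + x - \<delta>\<close>. Its quotient by
\<open>1 + x\<close> does not increase with \<open>x\<close>, whereas \<open>(1 + x - \<delta>) / (1 + x)\<close> increases strictly. So two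
different values of \<open>x\<close> are impossible.\<close>

lemma proportional_sin_max_cos_le:
  fixes c s c' s' :: "'n::finite \<Rightarrow> real"
  assumes circ: "\<And>i. (c i)\<^sup>2 + (s i)\<^sup>2 = 1" and circ': "\<And>i. (c' i)\<^sup>2 + (s' i)\<^sup>2 = 1"
    and low: "real CARD('n) - 2 < sum c UNIV" and up: "sum c UNIV < real CARD('n)"
    and eq: "sum c' UNIV = sum c UNIV"
    and ratio: "\<And>i. s' i = \<rho> * s i" and "\<rho> > 0" and max: "\<And>i. \<bar>s i\<bar> \<le> \<bar>s j\<bar>"
  shows "c' j \<le> c j"
proof (rule ccontr)
  assume "\<not> c' j \<le> c j"
  then have lt: "c j < c' j" by simp
  have max': "\<bar>s' i\<bar> \<le> \<bar>s' j\<bar>" for i using max[of i] \<open>\<rho> > 0\<close> by (simp add: ratio abs_mult)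
  have low': "real CARD('n) - 2 < sum c' UNIV" using low eq by simp
  note dom = cos_dominates[OF circ low max] and dom' = cos_dominates[OF circ' low' max']
  have sj: "s j \<noteq> 0" by (rule max_sin_nonzero[OF circ low up max])
  then have "s' j \<noteq> 0" using \<open>\<rho> > 0\<close> by (simp add: ratio)
  have "(c j)\<^sup>2 < 1" "(c' j)\<^sup>2 < 1"
    using circ[of j] circ'[of j] sj \<open>s' j \<noteq> 0\<close> by (smt (verit) zero_less_power2)+
  then have b: "-1 < c j" "c' j < 1" by (auto simp: abs_square_less_1)
  have "(\<Sum>i\<in>UNIV - {j}. (1 - c' i)) * (1 + c j) \<le> (\<Sum>i\<in>UNIV - {j}. (1 - c i)) * (1 + c' j)"
    unfolding sum_distrib_right
  proof (rule sum_mono)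
    fix i assume "i \<in> UNIV - {j}"
    then have "i \<noteq> j" by simp
    define r where "r = (s i / s j)\<^sup>2"
    have r: "0 \<le> r" "r \<le> 1"
      using max[of i] sj by (auto simp: r_def power_divide divide_le_eq abs_le_square_iff)
    have "(c i)\<^sup>2 = 1 - r * (1 - (c j)\<^sup>2)"
    proof -
      have "1 - (c j)\<^sup>2 = (s j)\<^sup>2" using circ[of j] by simp
      then show ?thesis using circ[of i] sj by (simp add: r_def power_divide)
    qed
    moreover have "(c' i)\<^sup>2 = 1 - r * (1 - (c' j)\<^sup>2)"
    proof -
      have "1 - (c' j)\<^sup>2 = (s' j)\<^sup>2" using circ'[of j] by simp
      moreover have "r = (s' i / s' j)\<^sup>2" using \<open>\<rho> > 0\<close> by (simp add: r_def ratio)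
      ultimately show ?thesis using circ'[of i] \<open>s' j \<noteq> 0\<close> by (simp add: power_divide)
    qed
    ultimately show "(1 - c' i) * (1 + c j) \<le> (1 - c i) * (1 + c' j)"
      using b lt r dom[OF \<open>i \<noteq> j\<close>] dom'[OF \<open>i \<noteq> j\<close>] by (intro cos_deficit_ratio_mono) auto
  qed
  then have "(sum c UNIV - (real CARD('n) - 2)) * (c' j - c j) \<le> 0"
    by (simp add: sum_one_minus_other_cos eq algebra_simps)
  moreover have "(sum c UNIV - (real CARD('n) - 2)) * (c' j - c j) > 0" using low lt by simp
  ultimately show False by simp
qed

lemma proportional_sin_unique:
  fixes c s c' s' :: "'n::finite \<Rightarrow> real"
  assumes circ: "\<And>i. (c i)\<^sup>2 + (s i)\<^sup>2 = 1" and circ': "\<And>i. (c' i)\<^sup>2 + (s' i)\<^sup>2 = 1"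
    and low: "real CARD('n) - 2 < sum c UNIV" and up: "sum c UNIV < real CARD('n)"
    and eq: "sum c' UNIV = sum c UNIV"
    and ratio: "\<And>i. s' i = \<rho> * s i" and "\<rho> > 0"
  shows "c' i = c i" and "s' i = s i"
proof -
  obtain j where max: "\<And>i. \<bar>s i\<bar> \<le> \<bar>s j\<bar>"
    using ex_max_abs[of s] by blast
  have max': "\<bar>s' i\<bar> \<le> \<bar>s' j\<bar>" for i using max[of i] \<open>\<rho> > 0\<close> by (simp add: ratio abs_mult)
  have ratio': "s i = (1 / \<rho>) * s' i" for i using \<open>\<rho> > 0\<close> by (simp add: ratio)
  have "c' j \<le> c j"
    by (rule proportional_sin_max_cos_le[OF circ circ' low up eq ratio \<open>\<rho> > 0\<close> max])
  moreover have "c j \<le> c' j"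
    by (rule proportional_sin_max_cos_le[where \<rho> = "1 / \<rho>" and s = s' and s' = s, OF circ' circ]) (use low up eq \<open>\<rho> > 0\<close> ratio' max' in auto)
  ultimately have cj: "c' j = c j" by simp
  have sj: "s j \<noteq> 0" by (rule max_sin_nonzero[OF circ low up max])
  have "(\<rho> * s j)\<^sup>2 = (s j)\<^sup>2" using circ[of j] circ'[of j] by (simp add: cj flip: ratio)
  then have "\<rho> = 1" using sj \<open>\<rho> > 0\<close> by (simp add: power_mult_distrib power2_eq_1_iff)
  then show s: "s' i = s i" by (simp add: ratio)
  show "c' i = c i"
  proof (cases "i = j")
    case False
    have "0 < c i" by (rule cos_dominates(1)[OF circ low max False])
    moreover have "0 < c' i" by (rule cos_dominates(1)[where s = s', OF circ' _ max' False]) (use low eq in simp)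
    moreover have "(c' i)\<^sup>2 = (c i)\<^sup>2" using circ[of i] circ'[of i] s by simp
    ultimately show ?thesis by (simp add: power2_eq_iff_nonneg)
  qed (simp add: cj)
qed

text \<open>Let \<open>j\<close> be the index of the largest modulus and \<open>t\<close> the angle at \<open>j\<close>, up to the sign of
its sine. The other coordinates take the positive root for the cosine. As \<open>t\<close> runs from \<open>0\<close> to \<open>\<pi>\<close>, the sum of
the cosines goes continuously from \<open>d\<close> to \<open>d - 2\<close>.\<close>

lemma proportional_sin_exists:
  fixes \<omega> :: "'n::finite \<Rightarrow> real"
  assumes "\<omega> l \<noteq> 0" and low: "real CARD('n) - 2 < L" and up: "L < real CARD('n)"
  shows "\<exists>c \<tau>. \<tau> > 0 \<and> sum c UNIV = L \<and> (\<forall>i. (c i)\<^sup>2 + (\<tau> * \<omega> i)\<^sup>2 = 1)"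
proof -
  obtain j where max: "\<And>i. \<bar>\<omega> i\<bar> \<le> \<bar>\<omega> j\<bar>"
    using ex_max_abs[of \<omega>] by blast
  have oj: "\<omega> j \<noteq> 0" using max[of l] assms(1) by auto
  define f where "f i t = sqrt (1 - (\<omega> i / \<omega> j)\<^sup>2 * (sin t)\<^sup>2)" for i and t :: real
  define c where "c t i = (if i = j then cos t else f i t)" for i t
  define G where "G t = cos t + (\<Sum>i\<in>UNIV - {j}. f i t)" for t
  have G: "sum (c t) UNIV = G t" for t
    by (simp add: G_def sum.remove[of _ j] c_def)
  have "CARD('n) \<ge> 1" by (simp add: Suc_leI)
  have G0: "G 0 = CARD('n)" and Gpi: "G pi = real CARD('n) - 2" using \<open>CARD('n) \<ge> 1\<close>
    by (simp_all add: G_def f_def card_Diff_subset of_nat_diff)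
  have "continuous_on {0..pi} G"
    unfolding G_def f_def by (intro continuous_intros)
  then obtain t where t: "0 \<le> t" "t \<le> pi" "G t = L"
    using IVT2'[of G pi L 0] low up G0 Gpi by (metis less_eq_real_def pi_ge_zero)
  have "t \<noteq> 0" "t \<noteq> pi" using t low up G0 Gpi by auto
  then have st: "sin t > 0" using t by (intro sin_gt_zero) auto
  define \<tau> where "\<tau> = sin t / \<bar>\<omega> j\<bar>"
  have "\<tau> > 0" using st oj by (simp add: \<tau>_def)
  moreover have "sum (c t) UNIV = L" using G t by simp
  moreover have "(c t i)\<^sup>2 + (\<tau> * \<omega> i)\<^sup>2 = 1" for i
  proof (cases "i = j")
    case True
    then show ?thesis using oj by (simp add: c_def \<tau>_def power_mult_distrib power_divide)
  next
    case False
    have "(\<omega> i / \<omega> j)\<^sup>2 \<le> 1"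
      using max[of i] oj by (auto simp: power_divide divide_le_eq abs_le_square_iff)
    then have "(\<omega> i / \<omega> j)\<^sup>2 * (sin t)\<^sup>2 \<le> 1 * 1"
      by (intro mult_mono) (auto simp: abs_square_le_1)
    then show ?thesis using False oj
      by (simp add: c_def f_def \<tau>_def power_mult_distrib power_divide mult.commute)
  qed
  ultimately show ?thesis by blast
qed

section \<open>Normals and curvature of the energy surface\<close>

lemma vec_nth_has_derivative: "((\<lambda>x. x $ i) has_derivative (\<lambda>h. h $ i)) (at x)"
  by (intro bounded_linear_imp_has_derivative bounded_linear_vec_nth)

lemma cos_vec_nth_has_derivative:
  "((\<lambda>x. cos (x $ i)) has_derivative (\<lambda>h. - sin (x $ i) * h $ i)) (at x)" for x :: "real ^ 'n"
  using DERIV_compose_FDERIV[OF DERIV_cos vec_nth_has_derivative] by (simp add: mult.commute)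

lemma sin_vec_nth_has_derivative:
  "((\<lambda>x. sin (x $ i)) has_derivative (\<lambda>h. cos (x $ i) * h $ i)) (at x)" for x :: "real ^ 'n"
  using DERIV_compose_FDERIV[OF DERIV_sin vec_nth_has_derivative] by (simp add: mult.commute)

lemma GDERIV_phi_lift: "GDERIV phi_lift x :> (\<chi> i. - 2 * sin (x $ i))" for x :: "real ^ 'n::finite"
proof -
  have "((\<lambda>x. 2 * (\<Sum>i\<in>UNIV. cos (x $ i))) has_derivative
      (\<lambda>h. 2 * (\<Sum>i\<in>UNIV. - sin (x $ i) * h $ i))) (at x)"
    by (intro has_derivative_mult_right has_derivative_sum cos_vec_nth_has_derivative)
  also have "(\<lambda>h. 2 * (\<Sum>i\<in>UNIV. - sin (x $ i) * h $ i)) = (\<lambda>h. h \<bullet> (\<chi> i. - 2 * sin (x $ i)))"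
    by (simp add: inner_vec_def sum_distrib_left mult_ac)
  finally show ?thesis unfolding gderiv_def phi_lift_def[abs_def] .
qed

lemma gradient_phi_lift: "gradient phi_lift x = (\<chi> i. - 2 * sin (x $ i))" for x :: "real ^ 'n::finite"
  unfolding gradient_def
proof (rule the_equality)
  fix D assume "GDERIV phi_lift x :> D"
  then have "(\<lambda>h. h \<bullet> D) = (\<lambda>h. h \<bullet> (\<chi> i. - 2 * sin (x $ i)))"
    unfolding gderiv_def using GDERIV_phi_lift[of x, unfolded gderiv_def] by (rule has_derivative_unique)
  then have "\<forall>h. h \<bullet> D = h \<bullet> (\<chi> i. - 2 * sin (x $ i))" unfolding fun_eq_iff .
  then show "D = (\<chi> i. - 2 * sin (x $ i))" unfolding vector_eq_ldot .
qed (rule GDERIV_phi_lift)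

lemma continuous_on_phi_lift: "continuous_on S phi_lift"
  unfolding phi_lift_def by (intro continuous_intros)

lemma phi_lift_uminus: "phi_lift (- x) = phi_lift x"
  by (simp add: phi_lift_def)

lemma unit_normal_uminus: "unit_normal phi_lift (- x) = - unit_normal phi_lift x"
proof -
  have "gradient phi_lift (- x) = - gradient phi_lift x" by (simp add: gradient_phi_lift vec_eq_iff)
  then show ?thesis by (simp add: unit_normal_def)
qed

lemma gradient_phi_has_derivative:
  "(gradient phi_lift has_derivative (\<lambda>u. \<chi> i. - 2 * cos (x $ i) * u $ i)) (at x)" for x :: "real ^ 'n::finite"
  unfolding gradient_phi_lift[abs_def]
proof (subst has_derivative_componentwise_within, intro ballI)
  fix b :: "real ^ 'n" assume "b \<in> Basis"
  then obtain i where "b = axis i 1" by (auto simp: Basis_vec_def)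
  moreover have "((\<lambda>x. - 2 * sin (x $ i)) has_derivative (\<lambda>u. - 2 * cos (x $ i) * u $ i)) (at x)"
    using has_derivative_mult_right[OF sin_vec_nth_has_derivative[of i x], of "- 2"] by (simp add: mult.assoc)
  ultimately show "((\<lambda>x. (\<chi> i. - 2 * sin (x $ i)) \<bullet> b) has_derivative (\<lambda>u. (\<chi> i. - 2 * cos (x $ i) * u $ i) \<bullet> b)) (at x)"
    by (simp add: inner_axis)
qed

text \<open>The critical values of \<open>phi_lift\<close> are \<open>2 d, 2 d - 4, \<dots>, - 2 d\<close>; only the two outermost of the
intervals between them are covered.\<close>

definition noncritical :: "real ^ 'n::finite \<Rightarrow> bool"
  where "noncritical x \<longleftrightarrow> 2 * real CARD('n) - 4 < \<bar>phi_lift x\<bar> \<and> \<bar>phi_lift x\<bar> < 2 * real CARD('n)"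

text \<open>The translation by \<open>(\<pi>, \<dots>, \<pi>)\<close> turns \<open>phi_lift\<close> into its negative. Multiplying the cosines
by this sign has the same effect and reduces negative energies to positive ones.\<close>

definition level_sign :: "real ^ 'n::finite \<Rightarrow> real"
  where "level_sign x = (if phi_lift x \<ge> 0 then 1 else - 1)"

lemma level_sign_square [simp]: "level_sign x * level_sign x = 1" "(level_sign x)\<^sup>2 = 1" "level_sign x \<noteq> 0"
  by (auto simp: level_sign_def)

lemma sum_level_sign_cos: "(\<Sum>i\<in>UNIV. level_sign x * cos (x $ i)) = \<bar>phi_lift x\<bar> / 2"
  unfolding level_sign_def phi_lift_def by (auto simp: sum_negf)

lemma level_sign_circle: "(level_sign x * cos t)\<^sup>2 + (sin t)\<^sup>2 = 1"
  by (simp add: power_mult_distrib)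

lemma noncritical_bounds:
  assumes "noncritical (x :: real ^ 'n::finite)"
  shows "real CARD('n) - 2 < (\<Sum>i\<in>UNIV. level_sign x * cos (x $ i))"
    and "(\<Sum>i\<in>UNIV. level_sign x * cos (x $ i)) < real CARD('n)"
  using assms by (auto simp: sum_level_sign_cos noncritical_def)

lemma gradient_phi_nonzero:
  assumes "noncritical x" shows "gradient phi_lift x \<noteq> 0"
proof
  assume "gradient phi_lift x = 0"
  then have s: "sin (x $ i) = 0" for i by (simp add: gradient_phi_lift vec_eq_iff)
  obtain j where "\<And>i. \<bar>sin (x $ i)\<bar> \<le> \<bar>sin (x $ j)\<bar>" using ex_max_abs[of "\<lambda>i. sin (x $ i)"] by blast
  from max_sin_nonzero[OF level_sign_circle noncritical_bounds[OF assms] this] s show False by simp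
qed

lemma norm_unit_normal: "noncritical x \<Longrightarrow> norm (unit_normal phi_lift x) = 1"
  using gradient_phi_nonzero[of x] by (simp add: unit_normal_def)

lemma gradient_eq_unit_normal: "gradient f x = norm (gradient f x) *\<^sub>R unit_normal f x"
  by (cases "gradient f x = 0") (simp_all add: unit_normal_def)

lemma torus_rel_iff: "torus_rel x y \<longleftrightarrow> (\<forall>i. sin (x $ i) = sin (y $ i) \<and> cos (x $ i) = cos (y $ i))"
proof
  assume "\<forall>i. sin (x $ i) = sin (y $ i) \<and> cos (x $ i) = cos (y $ i)"
  then have "\<forall>i. \<exists>n::int. x $ i = y $ i + 2 * pi * n" unfolding sin_cos_eq_iff .
  then obtain n :: "'a \<Rightarrow> int" where "\<And>i. x $ i = y $ i + 2 * pi * n i" by metis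
  then show "torus_rel x y"
    unfolding torus_rel_def by (intro exI[of _ "\<chi> i. n i"]) (simp add: vec_eq_iff latt_def)
next
  assume "torus_rel x y"
  then obtain m where "x = y + (2 * pi) *\<^sub>R latt m" unfolding torus_rel_def by blast
  then show "\<forall>i. sin (x $ i) = sin (y $ i) \<and> cos (x $ i) = cos (y $ i)"
    unfolding sin_cos_eq_iff by (auto simp: latt_def)
qed

text \<open>Equal normals make the sines of the coordinates proportional with a positive factor, and
equal energies give equal sums of cosines.\<close>

lemma unit_normal_injective:
  assumes "noncritical x" and level: "phi_lift y = phi_lift x"
    and normal: "unit_normal phi_lift y = unit_normal phi_lift x"
  shows "torus_rel y x"
proof -
  have "noncritical y" using assms(1) level by (simp add: noncritical_def)
  define \<rho> where "\<rho> = norm (gradient phi_lift y) / norm (gradient phi_lift x)"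
  have "\<rho> > 0"
    using gradient_phi_nonzero[OF \<open>noncritical x\<close>] gradient_phi_nonzero[OF \<open>noncritical y\<close>] by (simp add: \<rho>_def)
  have "gradient phi_lift y = (\<rho> * norm (gradient phi_lift x)) *\<^sub>R unit_normal phi_lift x"
    by (subst gradient_eq_unit_normal)
       (simp add: \<rho>_def normal gradient_phi_nonzero[OF \<open>noncritical x\<close>])
  also have "\<dots> = \<rho> *\<^sub>R gradient phi_lift x"
    by (simp flip: scaleR_scaleR gradient_eq_unit_normal)
  finally have "gradient phi_lift y = \<rho> *\<^sub>R gradient phi_lift x" .
  then have s: "sin (y $ i) = \<rho> * sin (x $ i)" for i by (simp add: gradient_phi_lift vec_eq_iff)
  have e: "level_sign y = level_sign x" by (simp add: level_sign_def level)
  have eq: "(\<Sum>i\<in>UNIV. level_sign x * cos (y $ i)) = (\<Sum>i\<in>UNIV. level_sign x * cos (x $ i))"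
    using sum_level_sign_cos[of x] sum_level_sign_cos[of y] by (simp only: e level)
  note u = proportional_sin_unique[OF level_sign_circle level_sign_circle noncritical_bounds[OF \<open>noncritical x\<close>] eq s \<open>\<rho> > 0\<close>]
  show ?thesis unfolding torus_rel_iff using u by (metis level_sign_square(3) mult_left_cancel)
qed

lemma unit_normal_surjective:
  fixes \<omega> :: "real ^ 'n::finite"
  assumes low: "2 * real CARD('n) - 4 < \<bar>lam\<bar>" and up: "\<bar>lam\<bar> < 2 * real CARD('n)" and "norm \<omega> = 1"
  obtains x where "phi_lift x = lam" "unit_normal phi_lift x = \<omega>"
proof -
  from \<open>norm \<omega> = 1\<close> have "\<omega> \<noteq> 0" by auto
  then obtain l where "\<omega> $ l \<noteq> 0" by (auto simp: vec_eq_iff)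
  then obtain c \<tau> where "\<tau> > 0" and c: "sum c UNIV = \<bar>lam\<bar> / 2" "\<And>i. (c i)\<^sup>2 + (\<tau> * \<omega> $ i)\<^sup>2 = 1"
    using proportional_sin_exists[of "\<lambda>i. \<omega> $ i" l "\<bar>lam\<bar> / 2"] low up by auto
  define \<epsilon> :: real where "\<epsilon> = (if lam \<ge> 0 then 1 else - 1)"
  have "\<exists>t. \<epsilon> * c i = cos t \<and> - \<tau> * \<omega> $ i = sin t" for i
  proof -
    have "(\<epsilon> * c i)\<^sup>2 + (- \<tau> * \<omega> $ i)\<^sup>2 = 1" using c(2)[of i] by (simp add: power_mult_distrib \<epsilon>_def)
    from sincos_total_2pi[OF this] show ?thesis by metis
  qed
  then obtain t where t: "\<And>i. \<epsilon> * c i = cos (t i)" "\<And>i. - \<tau> * \<omega> $ i = sin (t i)" by metis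
  define x where "x = (\<chi> i. t i)"
  have "phi_lift x = 2 * \<epsilon> * sum c UNIV" by (simp add: phi_lift_def x_def sum_distrib_left mult.assoc flip: t)
  also have "\<dots> = lam" by (simp add: c \<epsilon>_def)
  finally have "phi_lift x = lam" .
  moreover have g: "gradient phi_lift x = (2 * \<tau>) *\<^sub>R \<omega>"
    by (simp add: gradient_phi_lift x_def vec_eq_iff flip: t)
  then have "unit_normal phi_lift x = \<omega>"
    using \<open>\<tau> > 0\<close> \<open>norm \<omega> = 1\<close> by (simp add: unit_normal_def g)
  ultimately show thesis by (rule that)
qed

lemma unit_normal_has_derivative:
  fixes x :: "real ^ 'n::finite"
  assumes "noncritical x"
  obtains N' where "(unit_normal phi_lift has_derivative N') (at x)"
proof -
  let ?g = "gradient phi_lift :: real ^ 'n \<Rightarrow> _"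
  have g0: "?g x \<noteq> 0" using assms by (rule gradient_phi_nonzero)
  have "((\<lambda>y. norm (?g y)) has_derivative (\<lambda>u. (\<chi> i. - 2 * cos (x $ i) * u $ i) \<bullet> sgn (?g x))) (at x)"
    using GDERIV_norm[OF g0] unfolding gderiv_def
    by (rule has_derivative_compose[OF gradient_phi_has_derivative])
  from has_derivative_scaleR[OF Deriv.has_derivative_inverse[OF _ this] gradient_phi_has_derivative]
  have "\<exists>N'. ((\<lambda>y. ?g y /\<^sub>R norm (?g y)) has_derivative N') (at x)" using g0 by (intro exI) auto
  then show thesis using that unfolding unit_normal_def[abs_def] by blast
qed

text \<open>The gradient is its norm times the unit normal. So if the derivative of the unit normal
kills a tangent vector \<open>u\<close>, the Hessian maps \<open>u\<close> to a multiple of the gradient, which is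
impossible for \<open>u \<noteq> 0\<close>.\<close>

lemma total_curvature_nonzero:
  fixes x :: "real ^ 'n::finite"
  assumes "noncritical x" shows "total_curvature phi_lift x \<noteq> 0"
proof -
  let ?g = "gradient phi_lift :: real ^ 'n \<Rightarrow> _"
  let ?H = "\<lambda>u. (\<chi> i. - 2 * cos (x $ i) * u $ i) :: real ^ 'n"
  have g0: "?g x \<noteq> 0" using assms by (rule gradient_phi_nonzero)
  obtain N' where N': "(unit_normal phi_lift has_derivative N') (at x)"
    using unit_normal_has_derivative[OF assms] .
  have "((\<lambda>y. norm (?g y)) has_derivative (\<lambda>u. ?H u \<bullet> sgn (?g x))) (at x)"
    using GDERIV_norm[OF g0] unfolding gderiv_def
    by (rule has_derivative_compose[OF gradient_phi_has_derivative])
  from has_derivative_scaleR[OF this N']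
  have "(?g has_derivative (\<lambda>u. norm (?g x) *\<^sub>R N' u + (?H u \<bullet> sgn (?g x)) *\<^sub>R unit_normal phi_lift x)) (at x)"
    unfolding gradient_eq_unit_normal[symmetric] .
  from has_derivative_unique[OF this gradient_phi_has_derivative]
  have H: "norm (?g x) *\<^sub>R N' u + (?H u \<bullet> sgn (?g x)) *\<^sub>R unit_normal phi_lift x = ?H u" for u
    unfolding fun_eq_iff by blast
  have "0 \<notin> principal_curvatures phi_lift x"
  proof
    assume "0 \<in> principal_curvatures phi_lift x"
    then obtain u where u: "u \<noteq> 0" "u \<bullet> ?g x = 0" and "shape_operator phi_lift x u = 0"
      by (auto simp: principal_curvatures_def curvature_space_def level_tangent_def)
    then have "N' u = 0" by (simp add: shape_operator_def frechet_derivative_at[OF N', symmetric])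
    define b where "b = (?H u \<bullet> sgn (?g x)) / norm (?g x)"
    have "?H u = b *\<^sub>R ?g x"
      using H[of u] \<open>N' u = 0\<close> by (simp add: b_def unit_normal_def divide_inverse)
    then have eig: "cos (x $ i) * u $ i = b * sin (x $ i)" for i
      by (simp add: vec_eq_iff gradient_phi_lift)
    have "u \<bullet> ?g x = - 2 * (\<Sum>i\<in>UNIV. sin (x $ i) * u $ i)"
      by (simp add: inner_vec_def gradient_phi_lift sum_distrib_left mult_ac)
    with u(2) have "(\<Sum>i\<in>UNIV. sin (x $ i) * u $ i) = 0" by simp
    then have "u $ i = 0" for i
      by (rule second_form_nondegenerate[OF level_sign_circle noncritical_bounds[OF assms],
            where b = "level_sign x * b"]) (simp add: eig mult.assoc)
    then show False using u(1) by (simp add: vec_eq_iff)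
  qed
  then show ?thesis
    \<comment> \<open>If the set of principal curvatures were infinite, the product would be \<open>1\<close> by convention.\<close>
    unfolding total_curvature_def
    by (cases "finite (principal_curvatures phi_lift x)") (auto simp: power_eq_0_iff)
qed

lemma kappa_unit_normal:
  assumes "noncritical q"
  shows "kappa (unit_normal phi_lift q) (phi_lift q) = abs_torus q"
  unfolding kappa_def
proof (rule the_equality)
  show "abs_torus q \<in> Gamma_surface (phi_lift q) \<and>
      grad_phi (abs_torus q) /\<^sub>R norm (grad_phi (abs_torus q)) = unit_normal phi_lift q"
    by (simp add: Gamma_surface_def phi.abs_eq grad_phi.abs_eq unit_normal_def)
next
  fix k assume k: "k \<in> Gamma_surface (phi_lift q) \<and>
      grad_phi k /\<^sub>R norm (grad_phi k) = unit_normal phi_lift q"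
  obtain y where y: "k = abs_torus y" by (induct k) blast
  from k have "phi_lift y = phi_lift q" "unit_normal phi_lift y = unit_normal phi_lift q"
    by (auto simp: y Gamma_surface_def phi.abs_eq grad_phi.abs_eq unit_normal_def[of _ y])
  with unit_normal_injective[OF assms] show "k = abs_torus q" by (simp add: y torus.abs_eq_iff)
qed

text \<open>The amplitude for the direction \<open>- unit_normal phi_lift q\<close> evaluates the Fourier transform
at \<open>q - k\<close>, but the curvature and the gradient at \<open>- q\<close>, since \<open>phi_lift\<close> is even.\<close>

lemma born_intensity:
  fixes q :: "real ^ 'n::finite"
  assumes "noncritical q"
  shows "\<exists>B>0. \<forall>u k. cmod (born_amplitude (phi_lift q) u (abs_torus k) (- unit_normal phi_lift q)) =
    B * cmod (fourier u (abs_torus (q - k)))"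
proof -
  have nc: "noncritical (- q)" using assms by (simp add: noncritical_def phi_lift_uminus)
  have k: "kappa (- unit_normal phi_lift q) (phi_lift q) = abs_torus (- q)"
    using kappa_unit_normal[OF nc] by (simp add: unit_normal_uminus phi_lift_uminus)
  define B where "B = sqrt (2 * pi) / (sqrt \<bar>total_curvature phi_lift (- q)\<bar> * norm (gradient phi_lift (- q)))"
  have "B > 0"
    using total_curvature_nonzero[OF nc] gradient_phi_nonzero[OF nc] by (simp add: B_def)
  moreover have "cmod (born_amplitude (phi_lift q) u (abs_torus k) (- unit_normal phi_lift q)) =
    B * cmod (fourier u (abs_torus (q - k)))" for u k
    by (simp add: born_amplitude_def Let_def norm_mult norm_divide B_def curvature_K_def k
        kappa_unit_normal[OF assms] phi_curvature.abs_eq grad_phi.abs_eq minus_torus.abs_eq)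
  ultimately show ?thesis by blast
qed

section \<open>Differences of points on a level set\<close>

text \<open>The strict Cauchy-Schwarz inequality says that the Gram determinant is nonzero.\<close>

lemma dual_basis_of_pair:
  fixes g1 g2 :: "'a::euclidean_space"
  assumes "\<bar>g1 \<bullet> g2\<bar> < norm g1 * norm g2"
  obtains e1 e2 where "e1 \<bullet> g1 = 1" "e1 \<bullet> g2 = 0" "e2 \<bullet> g1 = 0" "e2 \<bullet> g2 = 1"
proof -
  define \<Delta> where "\<Delta> = (g1 \<bullet> g1) * (g2 \<bullet> g2) - (g1 \<bullet> g2)\<^sup>2"
  have "(g1 \<bullet> g2)\<^sup>2 < (norm g1 * norm g2)\<^sup>2"
    using power_strict_mono[OF assms abs_ge_zero, of 2] by simp
  then have "\<Delta> \<noteq> 0" by (simp add: \<Delta>_def power_mult_distrib power2_norm_eq_inner)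
  \<comment> \<open>Gram-Schmidt without normalization: \<open>a1\<close> is orthogonal to \<open>g2\<close> and \<open>a2\<close> to \<open>g1\<close>.\<close>
  define a1 where "a1 = (g2 \<bullet> g2) *\<^sub>R g1 - (g1 \<bullet> g2) *\<^sub>R g2"
  define a2 where "a2 = (g1 \<bullet> g1) *\<^sub>R g2 - (g1 \<bullet> g2) *\<^sub>R g1"
  have "a1 \<bullet> g1 = \<Delta>" "a1 \<bullet> g2 = 0" "a2 \<bullet> g1 = 0" "a2 \<bullet> g2 = \<Delta>"
    by (simp_all add: a1_def a2_def \<Delta>_def inner_diff_left inner_commute[of g2 g1] power2_eq_square)
  then show thesis using \<open>\<Delta> \<noteq> 0\<close> by (intro that[of "a1 /\<^sub>R \<Delta>" "a2 /\<^sub>R \<Delta>"]) simp_all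
qed

text \<open>The map \<open>(k, q) \<mapsto> (f k, f q, q - k)\<close> is differentiable with surjective derivative, so by
Sussmann's theorem it maps neighbourhoods to neighbourhoods; the slice of the image in which
the first two coordinates are fixed is open.\<close>

lemma level_pair_differences:
  fixes f :: "'a::euclidean_space \<Rightarrow> real"
  assumes cont: "continuous_on UNIV f" and g1: "GDERIV f k :> g1" and g2: "GDERIV f q :> g2"
    and indep: "\<bar>g1 \<bullet> g2\<bar> < norm g1 * norm g2" and "open T" "(k, q) \<in> T"
  obtains U where "open U" "q - k \<in> U"
    "\<And>p. p \<in> U \<Longrightarrow> \<exists>k' q'. (k', q') \<in> T \<and> f k' = f k \<and> f q' = f q \<and> p = q' - k'"
proof -
  obtain e1 e2 where e: "e1 \<bullet> g1 = 1" "e1 \<bullet> g2 = 0" "e2 \<bullet> g1 = 0" "e2 \<bullet> g2 = 1"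
    using dual_basis_of_pair[OF indep] .
  define F where "F = (\<lambda>z :: 'a \<times> 'a. (f (fst z), f (snd z), snd z - fst z))"
  define F' where "F' = (\<lambda>h :: 'a \<times> 'a. (fst h \<bullet> g1, snd h \<bullet> g2, snd h - fst h))"
  \<comment> \<open>A right inverse \<open>R\<close> of the derivative: \<open>s y\<close> is the first component of the preimage, and
    the second one is determined by the prescribed difference.\<close>
  define s where "s = (\<lambda>y :: real \<times> real \<times> 'a. fst y *\<^sub>R e1 + (fst (snd y) - snd (snd y) \<bullet> g2) *\<^sub>R e2)"
  define R where "R = (\<lambda>y. (s y, s y + snd (snd y)))"
  have "F (k, q) \<in> interior (F ` T)"
  proof (rule sussmann_open_mapping[where S = UNIV and f' = F' and g' = R])
    show "continuous_on UNIV F"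
      unfolding F_def
      by (intro continuous_intros continuous_on_compose2[OF cont]) auto
    have fst: "(fst has_derivative fst) (at (k, q))" and snd: "(snd has_derivative snd) (at (k, q))"
      by (simp_all add: bounded_linear_imp_has_derivative bounded_linear_fst bounded_linear_snd)
    have "((\<lambda>z. f (fst z)) has_derivative (\<lambda>h. fst h \<bullet> g1)) (at (k, q))"
      by (rule has_derivative_compose[OF fst]) (use g1 in \<open>simp add: gderiv_def\<close>)
    moreover have "((\<lambda>z. f (snd z)) has_derivative (\<lambda>h. snd h \<bullet> g2)) (at (k, q))"
      by (rule has_derivative_compose[OF snd]) (use g2 in \<open>simp add: gderiv_def\<close>)
    ultimately show "(F has_derivative F') (at (k, q))"
      unfolding F_def F'_def
      by (rule has_derivative_Pair[OF _ has_derivative_Pair[OF _ has_derivative_diff[OF snd fst]]])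
    show "bounded_linear R"
      unfolding linear_conv_bounded_linear[symmetric]
      by (rule linearI) (simp_all add: R_def s_def inner_add_left algebra_simps)
    show "F' \<circ> R = id"
      by (auto simp: fun_eq_iff F'_def R_def s_def inner_add_left e)
    show "(k, q) \<in> interior T" using \<open>open T\<close> \<open>(k, q) \<in> T\<close> by (simp add: interior_open)
  qed auto
  then have "q - k \<in> (\<lambda>p. (f k, f q, p)) -` interior (F ` T)" by (simp add: F_def)
  moreover have "open ((\<lambda>p. (f k, f q, p)) -` interior (F ` T))"
    by (intro open_vimage continuous_intros) simp
  moreover have "\<exists>k' q'. (k', q') \<in> T \<and> f k' = f k \<and> f q' = f q \<and> p = q' - k'"
    if "p \<in> (\<lambda>p. (f k, f q, p)) -` interior (F ` T)" for p
  proof -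
    from that have "(f k, f q, p) \<in> F ` T" using interior_subset by auto
    then obtain k' q' where "(k', q') \<in> T" "(f k, f q, p) = F (k', q')" by auto
    then show ?thesis by (intro exI[of _ k'] exI[of _ q']) (simp add: F_def)
  qed
  ultimately show thesis by (intro that)
qed

text \<open>Adjoin to \<open>f\<close> a linear coordinate along the level set. The image of a neighbourhood
contains a whole interval of this coordinate at the fixed value of \<open>f\<close>, and only countably
many of its values are taken on \<open>C\<close>.\<close>

lemma level_set_locally_uncountable:
  fixes f :: "'a::euclidean_space \<Rightarrow> real"
  assumes "DIM('a) \<ge> 2" and cont: "continuous_on UNIV f" and g: "GDERIV f k :> g" "g \<noteq> 0"
    and "open A" "k \<in> A" and "countable C"
  obtains k' where "k' \<in> A" "f k' = f k" "k' \<notin> C"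
proof -
  have "\<not> {e. g \<bullet> e = 0} \<subseteq> {0}"
    using dim_hyperplane[OF \<open>g \<noteq> 0\<close>] assms(1) by (simp flip: dim_eq_0)
  then obtain e where e: "g \<bullet> e = 0" "e \<noteq> 0" by blast
  define F where "F = (\<lambda>x. (f x, x \<bullet> e))"
  define R where "R = (\<lambda>y :: real \<times> real. (fst y / (g \<bullet> g)) *\<^sub>R g + (snd y / (e \<bullet> e)) *\<^sub>R e)"
  have "F k \<in> interior (F ` A)"
  proof (rule sussmann_open_mapping[where S = UNIV and f' = "\<lambda>h. (h \<bullet> g, h \<bullet> e)" and g' = R])
    show "continuous_on UNIV F" unfolding F_def by (intro continuous_intros cont)
    show "(F has_derivative (\<lambda>h. (h \<bullet> g, h \<bullet> e))) (at k)"
      unfolding F_def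
      by (rule has_derivative_Pair[OF g(1)[unfolded gderiv_def]
            bounded_linear_imp_has_derivative[OF bounded_linear_inner_left]])
    show "bounded_linear R" unfolding linear_conv_bounded_linear[symmetric]
      by (rule linearI) (simp_all add: R_def algebra_simps add_divide_distrib)
    show "(\<lambda>h. (h \<bullet> g, h \<bullet> e)) \<circ> R = id"
      using e \<open>g \<noteq> 0\<close> by (auto simp: fun_eq_iff R_def inner_add_left inner_commute[of e g])
    show "k \<in> interior A" using \<open>open A\<close> \<open>k \<in> A\<close> by (simp add: interior_open)
  qed auto
  then have "k \<bullet> e \<in> (\<lambda>t. (f k, t)) -` interior (F ` A)" by (simp add: F_def)
  moreover have "open ((\<lambda>t. (f k, t)) -` interior (F ` A))"
    by (intro open_vimage continuous_intros) simp
  ultimately obtain \<delta> where "\<delta> > 0" and \<delta>: "ball (k \<bullet> e) \<delta> \<subseteq> (\<lambda>t. (f k, t)) -` interior (F ` A)"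
    using open_contains_ball_eq by blast
  have "uncountable (ball (k \<bullet> e) \<delta>)" using \<open>\<delta> > 0\<close> by (rule uncountable_ball)
  moreover have "countable ((\<lambda>x. x \<bullet> e) ` C)" using \<open>countable C\<close> by simp
  ultimately have "\<not> ball (k \<bullet> e) \<delta> \<subseteq> (\<lambda>x. x \<bullet> e) ` C" by (metis countable_subset)
  then obtain t where t: "t \<in> ball (k \<bullet> e) \<delta>" "t \<notin> (\<lambda>x. x \<bullet> e) ` C" by blast
  have "(f k, t) \<in> interior (F ` A)" using t(1) \<delta> by auto
  then have "(f k, t) \<in> F ` A" using interior_subset by (rule rev_subsetD)
  then obtain k' where "k' \<in> A" "f k' = f k" "t = k' \<bullet> e" by (auto simp: F_def)
  with t(2) show thesis by (intro that[of k']) auto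
qed

lemma countable_torus_class: "countable {x. torus_rel x y}"
proof -
  have "{x. torus_rel x y} = range (\<lambda>m. y + (2 * pi) *\<^sub>R latt m)" by (auto simp: torus_rel_def)
  then show ?thesis by simp
qed

lemma normalized_eq:
  fixes a b :: "'a::real_normed_vector"
  assumes "a \<noteq> 0" "b \<noteq> 0" "norm a *\<^sub>R b = norm b *\<^sub>R a"
  shows "a /\<^sub>R norm a = b /\<^sub>R norm b"
proof -
  have "a /\<^sub>R norm a = (inverse (norm a) * inverse (norm b)) *\<^sub>R (norm b *\<^sub>R a)"
    using assms(2) by simp
  also have "\<dots> = b /\<^sub>R norm b"
    using assms(1) by (simp flip: assms(3))
  finally show ?thesis .
qed

text \<open>Dependent gradients have equal or opposite unit normals, and the point with the
opposite normal is \<open>- q\<close>.\<close>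

lemma gradients_independent:
  fixes k q :: "real ^ 'n::finite"
  assumes "noncritical q" and level: "phi_lift k = phi_lift q"
    and "\<not> torus_rel k q" "\<not> torus_rel k (- q)"
  shows "\<bar>gradient phi_lift k \<bullet> gradient phi_lift q\<bar> < norm (gradient phi_lift k) * norm (gradient phi_lift q)"
proof -
  let ?k = "gradient phi_lift k" and ?q = "gradient phi_lift q"
  have nc: "noncritical k" "noncritical (- q)"
    using assms(1) level by (simp_all add: noncritical_def phi_lift_uminus)
  have nz: "?k \<noteq> 0" "?q \<noteq> 0"
    using gradient_phi_nonzero[OF nc(1)] gradient_phi_nonzero[OF assms(1)] by auto
  have "\<bar>?k \<bullet> ?q\<bar> \<noteq> norm ?k * norm ?q"
  proof
    assume "\<bar>?k \<bullet> ?q\<bar> = norm ?k * norm ?q"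
    then consider "norm ?k *\<^sub>R ?q = norm ?q *\<^sub>R ?k" | "norm ?k *\<^sub>R ?q = - norm ?q *\<^sub>R ?k"
      unfolding norm_cauchy_schwarz_abs_eq by blast
    then show False
    proof cases
      case 1
      then have "unit_normal phi_lift k = unit_normal phi_lift q"
        unfolding unit_normal_def using nz by (intro normalized_eq)
      with unit_normal_injective[OF assms(1) level] assms(3) show False by simp
    next
      case 2
      then have "unit_normal phi_lift k = unit_normal phi_lift (- q)"
        unfolding unit_normal_uminus unfolding unit_normal_def
        using nz normalized_eq[of ?k "- ?q"] by simp
      with unit_normal_injective[OF nc(2)] level assms(4) show False by (simp add: phi_lift_uminus)
    qed
  qed
  with Cauchy_Schwarz_ineq2[of ?k ?q] show ?thesis by simp
qed

text \<open>The normal at \<open>k0\<close> may be parallel to \<open>\<omega>0\<close>. So \<open>k0\<close> is first replaced by a nearby point of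
the surface, after which the map to the differences is open.\<close>

lemma momentum_transfers_open:
  fixes N :: "('n::finite torus \<times> (real ^ 'n)) set"
  assumes "CARD('n) \<ge> 2" and low: "2 * real CARD('n) - 4 < \<bar>lam\<bar>" and up: "\<bar>lam\<bar> < 2 * real CARD('n)"
    and N: "openin (top_of_set (Gamma_surface lam \<times> sphere 0 1)) N" "(k0, \<omega>0) \<in> N"
  obtains U p0 where "open U" "p0 \<in> U"
    "\<And>p. p \<in> U \<Longrightarrow> \<exists>k q. phi_lift q = lam \<and> (abs_torus k, - unit_normal phi_lift q) \<in> N \<and> p = q - k"
proof -
  have nc: "noncritical x" if "phi_lift x = lam" for x :: "real ^ 'n"
    using that low up by (simp add: noncritical_def)
  obtain W where "open W" and W: "N = (Gamma_surface lam \<times> sphere 0 1) \<inter> W"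
    using N(1) by (auto simp: openin_open)
  obtain A B where "open A" "open B" "k0 \<in> A" "\<omega>0 \<in> B" and AB: "A \<times> B \<subseteq> W"
  proof -
    have "(k0, \<omega>0) \<in> W" using N(2) W by blast
    with \<open>open W\<close> show thesis by (rule open_prod_elim) (use that in blast)
  qed
  obtain y0 where y0: "k0 = abs_torus y0" by (induct k0) blast
  have "phi_lift y0 = lam" "norm \<omega>0 = 1"
    using N(2) by (auto simp: W y0 Gamma_surface_def phi.abs_eq)
  obtain q0 where q0: "phi_lift q0 = lam" "unit_normal phi_lift q0 = - \<omega>0"
    using unit_normal_surjective[OF low up, of "- \<omega>0"] \<open>norm \<omega>0 = 1\<close> by auto
  define A' where "A' = abs_torus -` A"
  \<comment> \<open>The torus carries the quotient topology.\<close>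
  have "open A'" using \<open>open A\<close> by (simp add: A'_def open_torus_def)
  have g: "GDERIV phi_lift x :> gradient phi_lift x" for x :: "real ^ 'n"
    using GDERIV_phi_lift[of x] by (simp add: gradient_phi_lift)
  have "DIM(real ^ 'n) \<ge> 2" using assms(1) by simp
  moreover note continuous_on_phi_lift g[of y0]
  moreover have "gradient phi_lift y0 \<noteq> 0" by (intro gradient_phi_nonzero nc) fact
  moreover note \<open>open A'\<close>
  moreover have "y0 \<in> A'" using \<open>k0 \<in> A\<close> by (simp add: A'_def y0)
  moreover have "countable ({x. torus_rel x q0} \<union> {x. torus_rel x (- q0)})"
    by (intro countable_Un countable_torus_class)
  ultimately obtain k1 where "k1 \<in> A'" "phi_lift k1 = phi_lift y0"
    "k1 \<notin> {x. torus_rel x q0} \<union> {x. torus_rel x (- q0)}"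
    by (rule level_set_locally_uncountable)
  then have k1: "k1 \<in> A'" "phi_lift k1 = lam" "\<not> torus_rel k1 q0" "\<not> torus_rel k1 (- q0)"
    using \<open>phi_lift y0 = lam\<close> by auto
  obtain N' where "(unit_normal phi_lift has_derivative N') (at q0)"
    using unit_normal_has_derivative[OF nc[OF q0(1)]] .
  then have "continuous (at q0) (\<lambda>q. - unit_normal phi_lift q)"
    by (rule continuous_minus[OF has_derivative_continuous])
  then have "\<exists>Q. open Q \<and> q0 \<in> Q \<and> (\<forall>q\<in>Q. - unit_normal phi_lift q \<in> B)"
    unfolding continuous_at_open using \<open>open B\<close> \<open>\<omega>0 \<in> B\<close> q0(2) by simp
  then obtain Q where "open Q" "q0 \<in> Q" and Q: "\<And>q. q \<in> Q \<Longrightarrow> - unit_normal phi_lift q \<in> B"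
    by blast
  have indep: "\<bar>gradient phi_lift k1 \<bullet> gradient phi_lift q0\<bar> < norm (gradient phi_lift k1) * norm (gradient phi_lift q0)"
    using k1 q0 by (intro gradients_independent nc) auto
  have "open (A' \<times> Q)" "(k1, q0) \<in> A' \<times> Q"
    using \<open>open A'\<close> \<open>open Q\<close> \<open>q0 \<in> Q\<close> k1(1) by (auto intro: open_Times)
  from level_pair_differences[OF continuous_on_phi_lift g g indep this]
  obtain U where U: "open U" "q0 - k1 \<in> U"
    "\<And>p. p \<in> U \<Longrightarrow> \<exists>k q. (k, q) \<in> A' \<times> Q \<and> phi_lift k = phi_lift k1 \<and> phi_lift q = phi_lift q0 \<and> p = q - k"
    by blast
  show thesis
  proof (rule that[OF U(1,2)])
    fix p assume "p \<in> U"
    from U(3)[OF this] obtain k q where kq: "k \<in> A'" "q \<in> Q" "phi_lift k = lam" "phi_lift q = lam" "p = q - k"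
      using k1(2) q0(1) by auto
    have "(abs_torus k, - unit_normal phi_lift q) \<in> A \<times> B" using kq Q by (auto simp: A'_def)
    then have "(abs_torus k, - unit_normal phi_lift q) \<in> N"
      using AB kq(3) norm_unit_normal[OF nc[OF kq(4)]] by (auto simp: W Gamma_surface_def phi.abs_eq)
    with kq show "\<exists>k q. phi_lift q = lam \<and> (abs_torus k, - unit_normal phi_lift q) \<in> N \<and> p = q - k" by blast
  qed
qed

section \<open>Determination of the potential\<close>

lemma finite_latt_preimage:
  assumes "bounded S" shows "finite {x :: int ^ 'n::finite. latt x \<in> S}"
proof -
  obtain b where b: "\<And>y. y \<in> S \<Longrightarrow> norm y \<le> b" using assms by (auto simp: bounded_iff)
  have "{x :: int ^ 'n. latt x \<in> S} \<subseteq> vec_lambda ` (UNIV \<rightarrow>\<^sub>E {- \<lceil>b\<rceil>..\<lceil>b\<rceil>})"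
  proof
    fix x :: "int ^ 'n" assume "x \<in> {x. latt x \<in> S}"
    then have "norm (latt x) \<le> b" using b by simp
    then have "\<bar>real_of_int (x $ i)\<bar> \<le> b" for i
      using component_le_norm_cart[of "latt x" i] by (simp add: latt_def)
    then have "x $ i \<in> {- \<lceil>b\<rceil>..\<lceil>b\<rceil>}" for i
      using le_of_int_ceiling[of b] by (smt (verit) atLeastAtMost_iff of_int_le_iff of_int_minus)
    then show "x \<in> vec_lambda ` (UNIV \<rightarrow>\<^sub>E {- \<lceil>b\<rceil>..\<lceil>b\<rceil>})"
      by (intro image_eqI[of _ _ "vec_nth x"]) auto
  qed
  then show ?thesis by (rule finite_subset) (intro finite_imageI finite_PiE; simp)
qed

lemma inj_latt: "inj_on latt S"
  by (auto simp: inj_on_def latt_def vec_eq_iff)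

lemma fourier_eq_trig_poly:
  fixes u :: "int ^ 'n::finite \<Rightarrow> complex"
  assumes "finite S" "\<And>x. u x \<noteq> 0 \<Longrightarrow> x \<in> S"
  shows "fourier u (abs_torus p) = of_real ((2 * pi) powr (- real CARD('n) / 2)) * trig_poly S latt u p"
proof -
  have "(\<Sum>\<^sub>\<infinity>x\<in>UNIV. u x * exp (- (\<i> * of_real (p \<bullet> latt x)))) = (\<Sum>\<^sub>\<infinity>x\<in>S. u x * exp (- (\<i> * of_real (p \<bullet> latt x))))"
    by (rule infsum_cong_neutral) (use assms(2) in auto)
  then show ?thesis using assms(1) by (simp add: fourier.abs_eq trig_poly_def)
qed

theorem theoremA13:
  fixes lam :: real
    and D0 D :: "(real ^ 'n::finite) set"
    and v0 v w :: "int ^ 'n \<Rightarrow> complex"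
    and N :: "('n torus \<times> (real ^ 'n)) set"
    and k0 :: "'n torus" and \<omega>0 :: "real ^ 'n"
  assumes "CARD('n) \<ge> 2"
    and "2 * real CARD('n) - 4 < \<bar>lam\<bar>" and "\<bar>lam\<bar> < 2 * real CARD('n)"
    and "open D0" and "convex D0" and "bounded D0" and "D0 \<inter> range latt \<noteq> {}"
    and "open D" and "convex D" and "bounded D" and "D \<inter> range latt \<noteq> {}"
    and "setdist D D0 > diameter D"
    and "\<And>x. v0 x \<noteq> 0 \<Longrightarrow> latt x \<in> D0" and "\<exists>x. v0 x \<noteq> 0"
    and "\<And>x. v x \<noteq> 0 \<Longrightarrow> latt x \<in> D"
    and "\<And>x. w x \<noteq> 0 \<Longrightarrow> latt x \<in> D"
    and "openin (top_of_set (Gamma_surface lam \<times> sphere 0 1)) N" and "(k0, \<omega>0) \<in> N"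
    and "\<And>k \<omega>. (k, \<omega>) \<in> N \<Longrightarrow>
           (cmod (born_amplitude lam (\<lambda>x. v x + v0 x) k \<omega>))\<^sup>2 =
           (cmod (born_amplitude lam (\<lambda>x. w x + v0 x) k \<omega>))\<^sup>2"
  shows "v = w"
proof
  fix x
  define S where "S = {x. latt x \<in> D} \<union> {x. latt x \<in> D0}"
  have S: "finite S" unfolding S_def using assms(6,10) by (simp add: finite_latt_preimage)
  obtain y where y: "v0 y \<noteq> 0" using assms(14) by blast
  obtain U p0 where U: "open U" "p0 \<in> U"
    "\<And>p. p \<in> U \<Longrightarrow> \<exists>k q. phi_lift q = lam \<and> (abs_torus k, - unit_normal phi_lift q) \<in> N \<and> p = q - k"
    using momentum_transfers_open[OF assms(1-3,17,18)] by blast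
  have mod: "cmod (trig_poly S latt (\<lambda>x. v x + v0 x) p) = cmod (trig_poly S latt (\<lambda>x. w x + v0 x) p)"
    if "p \<in> U" for p
  proof -
    from U(3)[OF that] obtain k q where kq: "phi_lift q = lam"
      "(abs_torus k, - unit_normal phi_lift q) \<in> N" "p = q - k" by blast
    have "noncritical q" using kq(1) assms(2,3) by (simp add: noncritical_def)
    then obtain B where "B > 0" and B: "\<And>u k. cmod (born_amplitude (phi_lift q) u (abs_torus k)
        (- unit_normal phi_lift q)) = B * cmod (fourier u (abs_torus (q - k)))"
      using born_intensity by blast
    have "cmod (fourier (\<lambda>x. v x + v0 x) (abs_torus p)) = cmod (fourier (\<lambda>x. w x + v0 x) (abs_torus p))"
      using assms(19)[OF kq(2)] \<open>B > 0\<close> B[unfolded kq(1)]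
      by (simp add: kq(3) power_mult_distrib)
    moreover have "x \<in> S" if "v x + v0 x \<noteq> 0 \<or> w x + v0 x \<noteq> 0" for x
      using that assms(13)[of x] assms(15)[of x] assms(16)[of x] by (cases "v0 x = 0") (auto simp: S_def)
    ultimately show ?thesis by (simp add: fourier_eq_trig_poly[OF S] norm_mult)
  qed
  show "v x = w x"
  proof (cases "x \<in> S")
    case True
    show ?thesis
      by (rule reference_determines[OF S inj_latt assms(9,5,10,12,15,16,13) _ y U(1,2) mod True])
         (use assms(13)[OF y] in \<open>auto simp: S_def\<close>)
  next
    case False
    then have "v x = 0" "w x = 0" using assms(15)[of x] assms(16)[of x] by (auto simp: S_def)
    then show ?thesis by simp
  qed
qed

end
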